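(* Let $\mathscr{K}$ be an essentially small rigid tt-category and let $\{F_i\colon \mathscr{K}\to\mathscr{L}_i\}_{i\in I}$ be a family of tt-functors to essentially small tt-categories. The following are equivalent: (i) The tt-functors $F_i\colon\mathscr{K}\to\mathscr{L}_i$ jointly detect $\otimes$-nilpotence of morphisms that are $\otimes$-nilpotent on their cones; that is, for every morphism $f$ in $\mathscr{K}$ that is $\otimes$-nilpotent on its cone, if $F_i(f)$ is $\otimes$-nilpotent for all $i\in I$ then $f$ is $\otimes$-nilpotent. (ii) The subset $\bigcup_{i\in I}\mathrm{Im}(\mathrm{Spc}(F_i))\subseteq\mathrm{Spc}(\mathscr{K})$ is patch-dense. (ii') The maps $\mathrm{Spc}(F_i)\colon\mathrm{Spc}(\mathscr{L}_i)\to\mathrm{Spc}(\mathscr{K})$ jointly distinguish supports.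
   Context: A tt-category is a triangulated category with a symmetric monoidal structure $(\otimes,\mathbb{1})$ such that $\otimes$ is exact in each variable; it is rigid if every object $k$ has a dual $k^\vee$ (every object is strongly dualizable). A tt-functor is an exact (strong) symmetric monoidal functor. A tt-ideal is a thick triangulated subcategory $\mathscr{J}$ (closed under direct summands) such that $k\in\mathscr{K}$, $m\in\mathscr{J}$ imply $k\otimes m\in\mathscr{J}$; a proper tt-ideal $\mathscr{P}\subsetneq\mathscr{K}$ is prime if $k\otimes\ell\in\mathscr{P}$ implies $k\in\mathscr{P}$ or $\ell\in\mathscr{P}$. For $\mathscr{K}$ essentially small, the spectrum $\mathrm{Spc}(\mathscr{K})$ is the set of prime tt-ideals, and the support of $k\in\mathscr{K}$ is $\mathrm{supp}(k)=\{\mathscr{P}\in\mathrm{Spc}(\mathscr{K}) : k\notin\mathscr{P}\}$. The topology on $\mathrm{Spc}(\mathscr{K})$ has as a basis of closed subsets the sets $\mathrm{supp}(k)$, $k\in\mathscr{K}$; it is a spectral space whose quasi-compact opens are exactly the complements $\mathrm{supp}(k)^c$. A tt-functor $F\colon\mathscr{K}\to\mathscr{L}$ induces the map $\mathrm{Spc}(F)\colon\mathrm{Spc}(\mathscr{L})\to\mathrm{Spc}(\mathscr{K})$, $\mathscr{Q}\mapsto F^{-1}(\mathscr{Q})$. The constructible (or patch) topology on a spectral space $X$ is the topology generated by the quasi-compact open subsets of $X$ and their complements. A subset is patch-dense if it is dense for this topology. A family of maps $\phi_i\colon Y_i\to\mathrm{Spc}(\mathscr{K})$ jointly distinguishes supports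 if for all $k,\ell\in\mathscr{K}$: $\phi_i^{-1}(\mathrm{supp}(k))=\phi_i^{-1}(\mathrm{supp}(\ell))$ for all $i$ implies $\mathrm{supp}(k)=\mathrm{supp}(\ell)$. A morphism $f\colon k\to\ell$ is $\otimes$-nilpotent if $f^{\otimes s}\colon k^{\otimes s}\to\ell^{\otimes s}$ is zero for $s\gg0$. It is $\otimes$-nilpotent on an object $m$ if $f^{\otimes s}\otimes m\colon k^{\otimes s}\otimes m\to\ell^{\otimes s}\otimes m$ is zero for $s\gg0$; $f$ is $\otimes$-nilpotent on its cone if this holds for $m=\mathrm{cone}(f)$. *)

(* Rigid tt-categories, tt-functors, the Balmer spectrum and the patch topology.

   A category is a record whose objects and arrows form sets over the types 'o and 'm.
   Every such category is small; an essentially small category is represented by a small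
   category equivalent to it. *)

theory Defs
  imports "HOL-Analysis.Abstract_Topology" "HOL-Algebra.Group"
begin

section \<open>Categories, functors, natural isomorphisms\<close>

record ('o, 'm) cat_data =
  Ob :: "'o set"
  Ar :: "'m set"
  Dom :: "'m \<Rightarrow> 'o"
  Cod :: "'m \<Rightarrow> 'o"
  Id :: "'o \<Rightarrow> 'm"
  Comp :: "'m \<Rightarrow> 'm \<Rightarrow> 'm"  (infixr "\<cdot>\<index>" 70)

definition Hom :: "('o, 'm, 'x) cat_data_scheme \<Rightarrow> 'o \<Rightarrow> 'o \<Rightarrow> 'm set" where
  "Hom C a b = {f \<in> Ar C. Dom C f = a \<and> Cod C f = b}"

locale category =
  fixes C :: "('o, 'm, 'x) cat_data_scheme" (structure)
  assumes Dom_Ob: "f \<in> Ar C \<Longrightarrow> Dom C f \<in> Ob C"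
    and Cod_Ob: "f \<in> Ar C \<Longrightarrow> Cod C f \<in> Ob C"
    and Id_Hom: "a \<in> Ob C \<Longrightarrow> Id C a \<in> Hom C a a"
    and Comp_Hom: "f \<in> Hom C a b \<Longrightarrow> g \<in> Hom C b c \<Longrightarrow> g \<cdot> f \<in> Hom C a c"
    and Id_left: "f \<in> Hom C a b \<Longrightarrow> Id C b \<cdot> f = f"
    and Id_right: "f \<in> Hom C a b \<Longrightarrow> f \<cdot> Id C a = f"
    and Comp_assoc: "f \<in> Hom C a b \<Longrightarrow> g \<in> Hom C b c \<Longrightarrow> h \<in> Hom C c d
      \<Longrightarrow> (h \<cdot> g) \<cdot> f = h \<cdot> (g \<cdot> f)"

definition inverse_arrows :: "('o, 'm, 'x) cat_data_scheme \<Rightarrow> 'm \<Rightarrow> 'm \<Rightarrow> bool" where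
  "inverse_arrows C f g \<longleftrightarrow> f \<in> Ar C \<and> g \<in> Hom C (Cod C f) (Dom C f)
     \<and> g \<cdot>\<^bsub>C\<^esub> f = Id C (Dom C f) \<and> f \<cdot>\<^bsub>C\<^esub> g = Id C (Cod C f)"

definition isos :: "('o, 'm, 'x) cat_data_scheme \<Rightarrow> 'o \<Rightarrow> 'o \<Rightarrow> 'm set" where
  "isos C a b = {f \<in> Hom C a b. \<exists>g. inverse_arrows C f g}"

definition inverse_of :: "('o, 'm, 'x) cat_data_scheme \<Rightarrow> 'm \<Rightarrow> 'm" where
  "inverse_of C f = (THE g. inverse_arrows C f g)"

definition is_functor ::
  "('o, 'm, 'x) cat_data_scheme \<Rightarrow> ('p, 'n, 'y) cat_data_scheme
    \<Rightarrow> ('o \<Rightarrow> 'p) \<Rightarrow> ('m \<Rightarrow> 'n) \<Rightarrow> bool" where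
  "is_functor C D Fo Fa \<longleftrightarrow>
     (\<forall>a\<in>Ob C. Fo a \<in> Ob D) \<and>
     (\<forall>a b. \<forall>f\<in>Hom C a b. Fa f \<in> Hom D (Fo a) (Fo b)) \<and>
     (\<forall>a\<in>Ob C. Fa (Id C a) = Id D (Fo a)) \<and>
     (\<forall>a b c. \<forall>f\<in>Hom C a b. \<forall>g\<in>Hom C b c. Fa (g \<cdot>\<^bsub>C\<^esub> f) = Fa g \<cdot>\<^bsub>D\<^esub> Fa f)"

definition equivalence_functor ::
  "('o, 'm, 'x) cat_data_scheme \<Rightarrow> ('p, 'n, 'y) cat_data_scheme
    \<Rightarrow> ('o \<Rightarrow> 'p) \<Rightarrow> ('m \<Rightarrow> 'n) \<Rightarrow> bool" where
  "equivalence_functor C D Fo Fa \<longleftrightarrow>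
     is_functor C D Fo Fa \<and>
     (\<forall>a\<in>Ob C. \<forall>b\<in>Ob C. bij_betw Fa (Hom C a b) (Hom D (Fo a) (Fo b))) \<and>
     (\<forall>b\<in>Ob D. \<exists>a\<in>Ob C. isos D (Fo a) b \<noteq> {})"

definition natural_iso ::
  "('o, 'm, 'x) cat_data_scheme \<Rightarrow> ('p, 'n, 'y) cat_data_scheme
    \<Rightarrow> ('o \<Rightarrow> 'p) \<Rightarrow> ('m \<Rightarrow> 'n) \<Rightarrow> ('o \<Rightarrow> 'p) \<Rightarrow> ('m \<Rightarrow> 'n) \<Rightarrow> ('o \<Rightarrow> 'n) \<Rightarrow> bool" where
  "natural_iso C D Fo Fa Go Ga \<alpha> \<longleftrightarrow>
     (\<forall>a\<in>Ob C. \<alpha> a \<in> isos D (Fo a) (Go a)) \<and>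
     (\<forall>a b. \<forall>f\<in>Hom C a b. \<alpha> b \<cdot>\<^bsub>D\<^esub> Fa f = Ga f \<cdot>\<^bsub>D\<^esub> \<alpha> a)"

section \<open>Triangulated categories and exact functors\<close>

text \<open>\<^term>\<open>Tri\<close> is the set of distinguished triangles (f, g, h), where
  f : a -> b, g : b -> c and h : c -> Shift a.\<close>

record ('o, 'm) tri_data = "('o, 'm) cat_data" +
  Plus :: "'m \<Rightarrow> 'm \<Rightarrow> 'm"  (infixl "\<oplus>\<^sub>A\<index>" 65)
  Zero :: "'o \<Rightarrow> 'o \<Rightarrow> 'm"
  ShiftO :: "'o \<Rightarrow> 'o"
  ShiftA :: "'m \<Rightarrow> 'm"
  Tri :: "('m \<times> 'm \<times> 'm) set"

definition hom_group :: "('o, 'm, 'x) tri_data_scheme \<Rightarrow> 'o \<Rightarrow> 'o \<Rightarrow> 'm monoid" where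
  "hom_group C a b = \<lparr>carrier = Hom C a b, mult = Plus C, one = Zero C a b\<rparr>"

definition hom_neg :: "('o, 'm, 'x) tri_data_scheme \<Rightarrow> 'm \<Rightarrow> 'm" where
  "hom_neg C f = inv\<^bsub>hom_group C (Dom C f) (Cod C f)\<^esub> f"

definition zero_object :: "('o, 'm, 'x) cat_data_scheme \<Rightarrow> 'o \<Rightarrow> bool" where
  "zero_object C z \<longleftrightarrow> z \<in> Ob C \<and>
     (\<forall>a\<in>Ob C. (\<exists>!f. f \<in> Hom C a z) \<and> (\<exists>!f. f \<in> Hom C z a))"

definition is_biproduct :: "('o, 'm, 'x) tri_data_scheme \<Rightarrow> 'o \<Rightarrow> 'o \<Rightarrow> 'o \<Rightarrow> bool" where
  "is_biproduct C a b s \<longleftrightarrow>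
     (\<exists>i\<in>Hom C a s. \<exists>j\<in>Hom C b s. \<exists>p\<in>Hom C s a. \<exists>q\<in>Hom C s b.
        p \<cdot>\<^bsub>C\<^esub> i = Id C a \<and> q \<cdot>\<^bsub>C\<^esub> j = Id C b \<and>
        q \<cdot>\<^bsub>C\<^esub> i = Zero C a b \<and> p \<cdot>\<^bsub>C\<^esub> j = Zero C b a \<and>
        (i \<cdot>\<^bsub>C\<^esub> p) \<oplus>\<^sub>A\<^bsub>C\<^esub> (j \<cdot>\<^bsub>C\<^esub> q) = Id C s)"

locale additive_category = category C
  for C :: "('o, 'm, 'x) tri_data_scheme" (structure) +
  assumes hom_comm_group: "a \<in> Ob C \<Longrightarrow> b \<in> Ob C \<Longrightarrow> comm_group (hom_group C a b)"
    and Comp_Plus_left: "f \<in> Hom C a b \<Longrightarrow> g \<in> Hom C b c \<Longrightarrow> g' \<in> Hom C b c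
      \<Longrightarrow> (g \<oplus>\<^sub>A g') \<cdot> f = (g \<cdot> f) \<oplus>\<^sub>A (g' \<cdot> f)"
    and Comp_Plus_right: "f \<in> Hom C a b \<Longrightarrow> f' \<in> Hom C a b \<Longrightarrow> g \<in> Hom C b c
      \<Longrightarrow> g \<cdot> (f \<oplus>\<^sub>A f') = (g \<cdot> f) \<oplus>\<^sub>A (g \<cdot> f')"
    and ex_zero_object: "\<exists>z. zero_object C z"
    and ex_biproduct: "a \<in> Ob C \<Longrightarrow> b \<in> Ob C \<Longrightarrow> \<exists>s\<in>Ob C. is_biproduct C a b s"

definition additive_functor ::
  "('o, 'm, 'x) tri_data_scheme \<Rightarrow> ('p, 'n, 'y) tri_data_scheme
    \<Rightarrow> ('o \<Rightarrow> 'p) \<Rightarrow> ('m \<Rightarrow> 'n) \<Rightarrow> bool" where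
  "additive_functor C D Fo Fa \<longleftrightarrow> is_functor C D Fo Fa \<and>
     (\<forall>a b. \<forall>f\<in>Hom C a b. \<forall>g\<in>Hom C a b. Fa (f \<oplus>\<^sub>A\<^bsub>C\<^esub> g) = Fa f \<oplus>\<^sub>A\<^bsub>D\<^esub> Fa g)"

definition triangle_shape ::
  "('o, 'm, 'x) tri_data_scheme \<Rightarrow> 'o \<Rightarrow> 'o \<Rightarrow> 'o \<Rightarrow> 'm \<Rightarrow> 'm \<Rightarrow> 'm \<Rightarrow> bool" where
  "triangle_shape C a b c f g h \<longleftrightarrow>
     f \<in> Hom C a b \<and> g \<in> Hom C b c \<and> h \<in> Hom C c (ShiftO C a)"

definition dist_triangle ::
  "('o, 'm, 'x) tri_data_scheme \<Rightarrow> 'o \<Rightarrow> 'o \<Rightarrow> 'o \<Rightarrow> 'm \<Rightarrow> 'm \<Rightarrow> 'm \<Rightarrow> bool" where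
  "dist_triangle C a b c f g h \<longleftrightarrow> triangle_shape C a b c f g h \<and> (f, g, h) \<in> Tri C"

locale triangulated_category = additive_category C
  for C :: "('o, 'm, 'x) tri_data_scheme" (structure) +
  assumes shift_additive: "additive_functor C C (ShiftO C) (ShiftA C)"
    and shift_equivalence: "equivalence_functor C C (ShiftO C) (ShiftA C)"
    and Tri_shape: "(f, g, h) \<in> Tri C \<Longrightarrow> \<exists>a b c. triangle_shape C a b c f g h"
    and Tri_iso_closed:
      "dist_triangle C a b c f g h \<Longrightarrow> triangle_shape C a' b' c' f' g' h' \<Longrightarrow>
       u \<in> isos C a a' \<Longrightarrow> v \<in> isos C b b' \<Longrightarrow> w \<in> isos C c c' \<Longrightarrow>
       v \<cdot> f = f' \<cdot> u \<Longrightarrow> w \<cdot> g = g' \<cdot> v \<Longrightarrow> ShiftA C u \<cdot> h = h' \<cdot> w \<Longrightarrow>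
       dist_triangle C a' b' c' f' g' h'"
    and Tri_id: "a \<in> Ob C \<Longrightarrow> zero_object C z \<Longrightarrow>
       dist_triangle C a a z (Id C a) (Zero C a z) (Zero C z (ShiftO C a))"
    and Tri_cone: "f \<in> Hom C a b \<Longrightarrow> \<exists>c g h. dist_triangle C a b c f g h"
    and Tri_rotate: "triangle_shape C a b c f g h \<Longrightarrow>
       dist_triangle C a b c f g h \<longleftrightarrow>
       dist_triangle C b c (ShiftO C a) g h (hom_neg C (ShiftA C f))"
    and Tri_morphism:
      "dist_triangle C a b c f g h \<Longrightarrow> dist_triangle C a' b' c' f' g' h' \<Longrightarrow>
       u \<in> Hom C a a' \<Longrightarrow> v \<in> Hom C b b' \<Longrightarrow> v \<cdot> f = f' \<cdot> u \<Longrightarrow>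
       \<exists>w\<in>Hom C c c'. w \<cdot> g = g' \<cdot> v \<and> ShiftA C u \<cdot> h = h' \<cdot> w"
    and Tri_octahedral:
      "dist_triangle C a b x f f1 f2 \<Longrightarrow> dist_triangle C b c y g g1 g2 \<Longrightarrow>
       dist_triangle C a c z (g \<cdot> f) h1 h2 \<Longrightarrow>
       \<exists>u v. dist_triangle C x z y u v (ShiftA C f1 \<cdot> g2) \<and>
         u \<cdot> f1 = h1 \<cdot> g \<and> h2 \<cdot> u = f2 \<and> v \<cdot> h1 = g1 \<and> g2 \<cdot> v = ShiftA C f \<cdot> h2"

definition exact_functor ::
  "('o, 'm, 'x) tri_data_scheme \<Rightarrow> ('p, 'n, 'y) tri_data_scheme
    \<Rightarrow> ('o \<Rightarrow> 'p) \<Rightarrow> ('m \<Rightarrow> 'n) \<Rightarrow> ('o \<Rightarrow> 'n) \<Rightarrow> bool" where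
  "exact_functor C D Fo Fa \<theta> \<longleftrightarrow>
     additive_functor C D Fo Fa \<and>
     natural_iso C D (\<lambda>a. Fo (ShiftO C a)) (\<lambda>f. Fa (ShiftA C f))
       (\<lambda>a. ShiftO D (Fo a)) (\<lambda>f. ShiftA D (Fa f)) \<theta> \<and>
     (\<forall>a b c f g h. dist_triangle C a b c f g h \<longrightarrow>
        dist_triangle D (Fo a) (Fo b) (Fo c) (Fa f) (Fa g) (\<theta> a \<cdot>\<^bsub>D\<^esub> Fa h))"

section \<open>Rigid tt-categories and tt-functors\<close>

text \<open>\<^term>\<open>Assoc K a b c\<close> : (a b) c -> a (b c), \<^term>\<open>LUnit K a\<close> : 1 a -> a,
  \<^term>\<open>RUnit K a\<close> : a 1 -> a and \<^term>\<open>Braid K a b\<close> : a b -> b a.\<close>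

record ('o, 'm) tt_data = "('o, 'm) tri_data" +
  TensO :: "'o \<Rightarrow> 'o \<Rightarrow> 'o"  (infixl "\<otimes>\<^sub>O\<index>" 75)
  TensA :: "'m \<Rightarrow> 'm \<Rightarrow> 'm"  (infixl "\<otimes>\<^sub>A\<index>" 75)
  Unit :: "'o"
  Assoc :: "'o \<Rightarrow> 'o \<Rightarrow> 'o \<Rightarrow> 'm"
  LUnit :: "'o \<Rightarrow> 'm"
  RUnit :: "'o \<Rightarrow> 'm"
  Braid :: "'o \<Rightarrow> 'o \<Rightarrow> 'm"

locale symmetric_monoidal_category = category K
  for K :: "('o, 'm, 'x) tt_data_scheme" (structure) +
  assumes Unit_Ob: "Unit K \<in> Ob K"
    and TensO_Ob: "a \<in> Ob K \<Longrightarrow> b \<in> Ob K \<Longrightarrow> a \<otimes>\<^sub>O b \<in> Ob K"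
    and TensA_Hom: "f \<in> Hom K a b \<Longrightarrow> g \<in> Hom K c d
      \<Longrightarrow> f \<otimes>\<^sub>A g \<in> Hom K (a \<otimes>\<^sub>O c) (b \<otimes>\<^sub>O d)"
    and TensA_Id: "a \<in> Ob K \<Longrightarrow> b \<in> Ob K \<Longrightarrow> Id K a \<otimes>\<^sub>A Id K b = Id K (a \<otimes>\<^sub>O b)"
    and TensA_Comp: "f \<in> Hom K a b \<Longrightarrow> g \<in> Hom K b c \<Longrightarrow> f' \<in> Hom K a' b' \<Longrightarrow> g' \<in> Hom K b' c'
      \<Longrightarrow> (g \<cdot> f) \<otimes>\<^sub>A (g' \<cdot> f') = (g \<otimes>\<^sub>A g') \<cdot> (f \<otimes>\<^sub>A f')"
    and Assoc_iso: "a \<in> Ob K \<Longrightarrow> b \<in> Ob K \<Longrightarrow> c \<in> Ob K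
      \<Longrightarrow> Assoc K a b c \<in> isos K ((a \<otimes>\<^sub>O b) \<otimes>\<^sub>O c) (a \<otimes>\<^sub>O (b \<otimes>\<^sub>O c))"
    and Assoc_natural: "f \<in> Hom K a a' \<Longrightarrow> g \<in> Hom K b b' \<Longrightarrow> h \<in> Hom K c c'
      \<Longrightarrow> Assoc K a' b' c' \<cdot> ((f \<otimes>\<^sub>A g) \<otimes>\<^sub>A h) = (f \<otimes>\<^sub>A (g \<otimes>\<^sub>A h)) \<cdot> Assoc K a b c"
    and LUnit_iso: "a \<in> Ob K \<Longrightarrow> LUnit K a \<in> isos K (Unit K \<otimes>\<^sub>O a) a"
    and LUnit_natural: "f \<in> Hom K a b \<Longrightarrow> LUnit K b \<cdot> (Id K (Unit K) \<otimes>\<^sub>A f) = f \<cdot> LUnit K a"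
    and RUnit_iso: "a \<in> Ob K \<Longrightarrow> RUnit K a \<in> isos K (a \<otimes>\<^sub>O Unit K) a"
    and RUnit_natural: "f \<in> Hom K a b \<Longrightarrow> RUnit K b \<cdot> (f \<otimes>\<^sub>A Id K (Unit K)) = f \<cdot> RUnit K a"
    and Braid_iso: "a \<in> Ob K \<Longrightarrow> b \<in> Ob K \<Longrightarrow> Braid K a b \<in> isos K (a \<otimes>\<^sub>O b) (b \<otimes>\<^sub>O a)"
    and Braid_natural: "f \<in> Hom K a a' \<Longrightarrow> g \<in> Hom K b b'
      \<Longrightarrow> Braid K a' b' \<cdot> (f \<otimes>\<^sub>A g) = (g \<otimes>\<^sub>A f) \<cdot> Braid K a b"
    and Braid_symmetric: "a \<in> Ob K \<Longrightarrow> b \<in> Ob K \<Longrightarrow> Braid K b a \<cdot> Braid K a b = Id K (a \<otimes>\<^sub>O b)"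
    and pentagon: "a \<in> Ob K \<Longrightarrow> b \<in> Ob K \<Longrightarrow> c \<in> Ob K \<Longrightarrow> d \<in> Ob K \<Longrightarrow>
      Assoc K a b (c \<otimes>\<^sub>O d) \<cdot> Assoc K (a \<otimes>\<^sub>O b) c d =
      (Id K a \<otimes>\<^sub>A Assoc K b c d) \<cdot> Assoc K a (b \<otimes>\<^sub>O c) d \<cdot> (Assoc K a b c \<otimes>\<^sub>A Id K d)"
    and triangle: "a \<in> Ob K \<Longrightarrow> b \<in> Ob K \<Longrightarrow>
      (Id K a \<otimes>\<^sub>A LUnit K b) \<cdot> Assoc K a (Unit K) b = RUnit K a \<otimes>\<^sub>A Id K b"
    and hexagon: "a \<in> Ob K \<Longrightarrow> b \<in> Ob K \<Longrightarrow> c \<in> Ob K \<Longrightarrow>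
      Assoc K b c a \<cdot> Braid K a (b \<otimes>\<^sub>O c) \<cdot> Assoc K a b c =
      (Id K b \<otimes>\<^sub>A Braid K a c) \<cdot> Assoc K b a c \<cdot> (Braid K a b \<otimes>\<^sub>A Id K c)"

locale tt_category = triangulated_category K + symmetric_monoidal_category K
  for K :: "('o, 'm, 'x) tt_data_scheme" (structure) +
  assumes tensor_exact_left: "a \<in> Ob K \<Longrightarrow>
      \<exists>\<theta>. exact_functor K K (\<lambda>x. x \<otimes>\<^sub>O a) (\<lambda>f. f \<otimes>\<^sub>A Id K a) \<theta>"
    and tensor_exact_right: "a \<in> Ob K \<Longrightarrow>
      \<exists>\<theta>. exact_functor K K (\<lambda>x. a \<otimes>\<^sub>O x) (\<lambda>f. Id K a \<otimes>\<^sub>A f) \<theta>"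

definition is_dual :: "('o, 'm, 'x) tt_data_scheme \<Rightarrow> 'o \<Rightarrow> 'o \<Rightarrow> bool" where
  "is_dual K a d \<longleftrightarrow>
     (\<exists>coev\<in>Hom K (Unit K) (a \<otimes>\<^sub>O\<^bsub>K\<^esub> d). \<exists>ev\<in>Hom K (d \<otimes>\<^sub>O\<^bsub>K\<^esub> a) (Unit K).
        RUnit K a \<cdot>\<^bsub>K\<^esub> (Id K a \<otimes>\<^sub>A\<^bsub>K\<^esub> ev) \<cdot>\<^bsub>K\<^esub> Assoc K a d a
          \<cdot>\<^bsub>K\<^esub> (coev \<otimes>\<^sub>A\<^bsub>K\<^esub> Id K a) = LUnit K a \<and>
        LUnit K d \<cdot>\<^bsub>K\<^esub> (ev \<otimes>\<^sub>A\<^bsub>K\<^esub> Id K d) \<cdot>\<^bsub>K\<^esub> inverse_of K (Assoc K d a d)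
          \<cdot>\<^bsub>K\<^esub> (Id K d \<otimes>\<^sub>A\<^bsub>K\<^esub> coev) = RUnit K d)"

locale rigid_tt_category = tt_category K
  for K :: "('o, 'm, 'x) tt_data_scheme" (structure) +
  assumes ex_dual: "a \<in> Ob K \<Longrightarrow> \<exists>d\<in>Ob K. is_dual K a d"

text \<open>\<^term>\<open>FShift F a\<close> : F (Shift a) -> Shift (F a), \<^term>\<open>FMult F a b\<close> : F a F b -> F (a b)
  and \<^term>\<open>FUnit F\<close> : 1 -> F 1.\<close>

record ('o, 'm, 'p, 'n) tt_functor_data =
  FOb :: "'o \<Rightarrow> 'p"
  FAr :: "'m \<Rightarrow> 'n"
  FShift :: "'o \<Rightarrow> 'n"
  FMult :: "'o \<Rightarrow> 'o \<Rightarrow> 'n"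
  FUnit :: "'n"

definition strong_symmetric_monoidal ::
  "('o, 'm, 'x) tt_data_scheme \<Rightarrow> ('p, 'n, 'y) tt_data_scheme
    \<Rightarrow> ('o \<Rightarrow> 'p) \<Rightarrow> ('m \<Rightarrow> 'n) \<Rightarrow> ('o \<Rightarrow> 'o \<Rightarrow> 'n) \<Rightarrow> 'n \<Rightarrow> bool" where
  "strong_symmetric_monoidal K L Fo Fa \<mu> \<epsilon> \<longleftrightarrow>
     is_functor K L Fo Fa \<and>
     \<epsilon> \<in> isos L (Unit L) (Fo (Unit K)) \<and>
     (\<forall>a\<in>Ob K. \<forall>b\<in>Ob K. \<mu> a b \<in> isos L (Fo a \<otimes>\<^sub>O\<^bsub>L\<^esub> Fo b) (Fo (a \<otimes>\<^sub>O\<^bsub>K\<^esub> b))) \<and>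
     (\<forall>a a' b b'. \<forall>f\<in>Hom K a a'. \<forall>g\<in>Hom K b b'.
        \<mu> a' b' \<cdot>\<^bsub>L\<^esub> (Fa f \<otimes>\<^sub>A\<^bsub>L\<^esub> Fa g) = Fa (f \<otimes>\<^sub>A\<^bsub>K\<^esub> g) \<cdot>\<^bsub>L\<^esub> \<mu> a b) \<and>
     (\<forall>a\<in>Ob K. \<forall>b\<in>Ob K. \<forall>c\<in>Ob K.
        Fa (Assoc K a b c) \<cdot>\<^bsub>L\<^esub> \<mu> (a \<otimes>\<^sub>O\<^bsub>K\<^esub> b) c \<cdot>\<^bsub>L\<^esub> (\<mu> a b \<otimes>\<^sub>A\<^bsub>L\<^esub> Id L (Fo c)) =
        \<mu> a (b \<otimes>\<^sub>O\<^bsub>K\<^esub> c) \<cdot>\<^bsub>L\<^esub> (Id L (Fo a) \<otimes>\<^sub>A\<^bsub>L\<^esub> \<mu> b c) \<cdot>\<^bsub>L\<^esub> Assoc L (Fo a) (Fo b) (Fo c)) \<and>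
     (\<forall>a\<in>Ob K. Fa (LUnit K a) \<cdot>\<^bsub>L\<^esub> \<mu> (Unit K) a \<cdot>\<^bsub>L\<^esub> (\<epsilon> \<otimes>\<^sub>A\<^bsub>L\<^esub> Id L (Fo a)) = LUnit L (Fo a)) \<and>
     (\<forall>a\<in>Ob K. Fa (RUnit K a) \<cdot>\<^bsub>L\<^esub> \<mu> a (Unit K) \<cdot>\<^bsub>L\<^esub> (Id L (Fo a) \<otimes>\<^sub>A\<^bsub>L\<^esub> \<epsilon>) = RUnit L (Fo a)) \<and>
     (\<forall>a\<in>Ob K. \<forall>b\<in>Ob K. Fa (Braid K a b) \<cdot>\<^bsub>L\<^esub> \<mu> a b = \<mu> b a \<cdot>\<^bsub>L\<^esub> Braid L (Fo a) (Fo b))"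

definition tt_functor ::
  "('o, 'm, 'x) tt_data_scheme \<Rightarrow> ('p, 'n, 'y) tt_data_scheme
    \<Rightarrow> ('o, 'm, 'p, 'n) tt_functor_data \<Rightarrow> bool" where
  "tt_functor K L F \<longleftrightarrow>
     exact_functor K L (FOb F) (FAr F) (FShift F) \<and>
     strong_symmetric_monoidal K L (FOb F) (FAr F) (FMult F) (FUnit F)"

section \<open>The spectrum\<close>

text \<open>A full replete subcategory is represented by its set of objects.\<close>

definition thick_subcategory :: "('o, 'm, 'x) tri_data_scheme \<Rightarrow> 'o set \<Rightarrow> bool" where
  "thick_subcategory C J \<longleftrightarrow>
     J \<subseteq> Ob C \<and>
     (\<forall>z. zero_object C z \<longrightarrow> z \<in> J) \<and>
     (\<forall>a\<in>J. \<forall>b\<in>Ob C. isos C a b \<noteq> {} \<longrightarrow> b \<in> J) \<and>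
     (\<forall>a\<in>Ob C. a \<in> J \<longleftrightarrow> ShiftO C a \<in> J) \<and>
     (\<forall>a b c f g h. dist_triangle C a b c f g h \<longrightarrow>
        (a \<in> J \<and> b \<in> J \<longrightarrow> c \<in> J) \<and> (b \<in> J \<and> c \<in> J \<longrightarrow> a \<in> J) \<and> (a \<in> J \<and> c \<in> J \<longrightarrow> b \<in> J)) \<and>
     (\<forall>a\<in>Ob C. \<forall>b\<in>Ob C. \<forall>s\<in>J. is_biproduct C a b s \<longrightarrow> a \<in> J \<and> b \<in> J)"

definition tt_ideal :: "('o, 'm, 'x) tt_data_scheme \<Rightarrow> 'o set \<Rightarrow> bool" where
  "tt_ideal K J \<longleftrightarrow> thick_subcategory K J \<and> (\<forall>k\<in>Ob K. \<forall>m\<in>J. k \<otimes>\<^sub>O\<^bsub>K\<^esub> m \<in> J)"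

definition prime_tt_ideal :: "('o, 'm, 'x) tt_data_scheme \<Rightarrow> 'o set \<Rightarrow> bool" where
  "prime_tt_ideal K P \<longleftrightarrow> tt_ideal K P \<and> P \<noteq> Ob K \<and>
     (\<forall>k\<in>Ob K. \<forall>l\<in>Ob K. k \<otimes>\<^sub>O\<^bsub>K\<^esub> l \<in> P \<longrightarrow> k \<in> P \<or> l \<in> P)"

definition Spc :: "('o, 'm, 'x) tt_data_scheme \<Rightarrow> 'o set set" where
  "Spc K = {P. prime_tt_ideal K P}"

definition supp :: "('o, 'm, 'x) tt_data_scheme \<Rightarrow> 'o \<Rightarrow> 'o set set" where
  "supp K k = {P \<in> Spc K. k \<notin> P}"

text \<open>The generating family is closed under finite intersections, so it is a basis of opens and
  the supports form a basis of closed subsets.\<close>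

definition Spc_topology :: "('o, 'm, 'x) tt_data_scheme \<Rightarrow> 'o set topology" where
  "Spc_topology K = topology_generated_by {Spc K - supp K k | k. k \<in> Ob K}"

definition Spc_map ::
  "('o, 'm, 'x) tt_data_scheme \<Rightarrow> ('o, 'm, 'p, 'n) tt_functor_data \<Rightarrow> 'p set \<Rightarrow> 'o set" where
  "Spc_map K F Q = {k \<in> Ob K. FOb F k \<in> Q}"

definition patch_topology :: "'a topology \<Rightarrow> 'a topology" where
  "patch_topology X = topology_generated_by
     ({U. openin X U \<and> compactin X U} \<union> {topspace X - U | U. openin X U \<and> compactin X U})"

definition patch_dense :: "'a topology \<Rightarrow> 'a set \<Rightarrow> bool" where
  "patch_dense X S \<longleftrightarrow> S \<subseteq> topspace X \<and> patch_topology X closure_of S = topspace X"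

definition jointly_distinguish_supports ::
  "('o, 'm, 'x) tt_data_scheme \<Rightarrow> 'i set \<Rightarrow> ('i \<Rightarrow> 'y set) \<Rightarrow> ('i \<Rightarrow> 'y \<Rightarrow> 'o set) \<Rightarrow> bool" where
  "jointly_distinguish_supports K I Y \<phi> \<longleftrightarrow>
     (\<forall>k\<in>Ob K. \<forall>l\<in>Ob K.
        (\<forall>i\<in>I. {y \<in> Y i. \<phi> i y \<in> supp K k} = {y \<in> Y i. \<phi> i y \<in> supp K l}) \<longrightarrow>
        supp K k = supp K l)"

section \<open>Tensor nilpotence\<close>

primrec tensor_power_ob :: "('o, 'm, 'x) tt_data_scheme \<Rightarrow> 'o \<Rightarrow> nat \<Rightarrow> 'o" where
  "tensor_power_ob K k 0 = Unit K"
| "tensor_power_ob K k (Suc s) = tensor_power_ob K k s \<otimes>\<^sub>O\<^bsub>K\<^esub> k"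

primrec tensor_power_ar :: "('o, 'm, 'x) tt_data_scheme \<Rightarrow> 'm \<Rightarrow> nat \<Rightarrow> 'm" where
  "tensor_power_ar K f 0 = Id K (Unit K)"
| "tensor_power_ar K f (Suc s) = tensor_power_ar K f s \<otimes>\<^sub>A\<^bsub>K\<^esub> f"

definition tensor_nilpotent :: "('o, 'm, 'x) tt_data_scheme \<Rightarrow> 'm \<Rightarrow> bool" where
  "tensor_nilpotent K f \<longleftrightarrow>
     (\<forall>\<^sub>F s in sequentially. tensor_power_ar K f s =
        Zero K (tensor_power_ob K (Dom K f) s) (tensor_power_ob K (Cod K f) s))"

definition tensor_nilpotent_on :: "('o, 'm, 'x) tt_data_scheme \<Rightarrow> 'm \<Rightarrow> 'o \<Rightarrow> bool" where
  "tensor_nilpotent_on K f m \<longleftrightarrow>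
     (\<forall>\<^sub>F s in sequentially. tensor_power_ar K f s \<otimes>\<^sub>A\<^bsub>K\<^esub> Id K m =
        Zero K (tensor_power_ob K (Dom K f) s \<otimes>\<^sub>O\<^bsub>K\<^esub> m)
               (tensor_power_ob K (Cod K f) s \<otimes>\<^sub>O\<^bsub>K\<^esub> m))"

text \<open>Any two cones of f are isomorphic, so it does not matter which one is taken.\<close>

definition tensor_nilpotent_on_cone :: "('o, 'm, 'x) tt_data_scheme \<Rightarrow> 'm \<Rightarrow> bool" where
  "tensor_nilpotent_on_cone K f \<longleftrightarrow>
     (\<exists>m g h. dist_triangle K (Dom K f) (Cod K f) m f g h \<and> tensor_nilpotent_on K f m)"

definition jointly_detect_tensor_nilpotence_on_cone ::
  "('o, 'm, 'x) tt_data_scheme \<Rightarrow> 'i set \<Rightarrow> ('i \<Rightarrow> ('p, 'n, 'y) tt_data_scheme)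
    \<Rightarrow> ('i \<Rightarrow> ('o, 'm, 'p, 'n) tt_functor_data) \<Rightarrow> bool" where
  "jointly_detect_tensor_nilpotence_on_cone K I L F \<longleftrightarrow>
     (\<forall>f\<in>Ar K. tensor_nilpotent_on_cone K f \<longrightarrow>
        (\<forall>i\<in>I. tensor_nilpotent (L i) (FAr (F i) f)) \<longrightarrow> tensor_nilpotent K f)"

end

(* For an arrow f : a -> b, the objects m on which f is tensor-nilpotent form a tt-ideal N(f). If f
   is not tensor-nilpotent, then N(f) contains no tensor power of a, so some prime contains N(f)
   and avoids a. If f is tensor-nilpotent and its cone lies in a prime P, then a lies in P, because
   f becomes invertible modulo P. Hence an f that is tensor-nilpotent on its cone c is
   tensor-nilpotent iff supp(a) is contained in supp(c).

   All three conditions are compared with the following one: whenever some prime P of K satisfies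
   k \<notin> P and l \<in> P, such a prime can be found among the F_i^{-1}(Q). Density unfolds to this because
   the compact opens of Spc K are exactly the sets of primes containing a fixed object. The criterion
   above yields detection from it. Conversely, for objects k and l let h : c -> Shift 1 be the
   connecting map of the cone of the coevaluation of l. Then tensoring with l kills h, so the tensor
   product of h with k is nilpotent on its cone; it is nilpotent iff supp(k) is contained in
   supp(l). *)

theory Submission
  imports Defs
begin

section \<open>Additive categories\<close>

text \<open>The \<open>L i\<close> are not assumed rigid, so the nilpotence criterion is proved in
  an arbitrary tt-category and applied both to \<open>K\<close> and to each \<open>L i\<close>;
  duals enter through the coevaluation of \<open>l\<close> in \<open>K\<close>. No Verdier quotient
  is formed: invertibility of an arrow modulo \<open>P\<close> is expressed by its cone lying in
  \<open>P\<close>, which is stable under composition (octahedral axiom) and under tensoring. A zero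
  arrow with this property has a split cone, so its source lies in \<open>P\<close>.

  Why supports govern the nilpotence of h tensor k: let e be l tensor its dual, so that h belongs to
  a triangle 1 -> e -> c -> Shift 1. The cone of h tensor k is Shift e tensor k. A prime containing
  l contains e and this cone, but not c, since e and c together would force the unit into it. On
  such primes the source c tensor k is a member exactly when k is.

  Condition (ii') compares supports by equality, the intermediate condition by inclusion; replacing
  k by the direct sum of k and l passes from one to the other.

  Nilpotence only asks whether arrows vanish, and vanishing is invariant under isomorphism of
  arrows, so associators and braidings need not be tracked explicitly.\<close>

context category
begin

lemma Hom_Ob: "f \<in> Hom C a b \<Longrightarrow> a \<in> Ob C \<and> b \<in> Ob C"
  using Dom_Ob Cod_Ob by (auto simp: Hom_def)

lemma isos_Hom: "f \<in> isos C a b \<Longrightarrow> f \<in> Hom C a b"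
  by (simp add: isos_def)

lemma isosI:
  assumes "f \<in> Hom C a b" "g \<in> Hom C b a" "g \<cdot> f = Id C a" "f \<cdot> g = Id C b"
  shows "f \<in> isos C a b"
  using assms by (auto simp: isos_def inverse_arrows_def Hom_def)

lemma isosE:
  assumes "f \<in> isos C a b"
  obtains g where "f \<in> Hom C a b" "g \<in> Hom C b a" "g \<cdot> f = Id C a" "f \<cdot> g = Id C b"
  using assms by (auto simp: isos_def inverse_arrows_def Hom_def)

lemma isos_Id: "a \<in> Ob C \<Longrightarrow> Id C a \<in> isos C a a"
  by (rule isosI[where g = "Id C a"]) (auto intro: Id_Hom Id_left)

lemma isos_sym: "f \<in> isos C a b \<Longrightarrow> \<exists>g. g \<in> isos C b a \<and> g \<cdot> f = Id C a \<and> f \<cdot> g = Id C b"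
  by (metis isosE isosI)

lemma isos_Comp:
  assumes "f \<in> isos C a b" "g \<in> isos C b c"
  shows "g \<cdot> f \<in> isos C a c"
proof -
  obtain f' where f: "f \<in> Hom C a b" "f' \<in> Hom C b a" "f' \<cdot> f = Id C a" "f \<cdot> f' = Id C b"
    using assms(1) by (rule isosE)
  obtain g' where g: "g \<in> Hom C b c" "g' \<in> Hom C c b" "g' \<cdot> g = Id C b" "g \<cdot> g' = Id C c"
    using assms(2) by (rule isosE)
  have gf: "g \<cdot> f \<in> Hom C a c" and fg': "f' \<cdot> g' \<in> Hom C c a"
    using f g Comp_Hom by blast+
  have "(f' \<cdot> g') \<cdot> (g \<cdot> f) = f' \<cdot> ((g' \<cdot> g) \<cdot> f)"
    using Comp_assoc f g gf by metis
  moreover have "(g \<cdot> f) \<cdot> (f' \<cdot> g') = g \<cdot> ((f \<cdot> f') \<cdot> g')"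
    using Comp_assoc f g fg' by metis
  ultimately show ?thesis
    using f g gf fg' by (intro isosI[where g = "f' \<cdot> g'"]) (simp_all add: Id_left)
qed

end

section \<open>Isomorphism of objects and of arrows\<close>

definition isomorphic :: "('o, 'm, 'x) cat_data_scheme \<Rightarrow> 'o \<Rightarrow> 'o \<Rightarrow> bool" where
  "isomorphic C a b \<longleftrightarrow> isos C a b \<noteq> {}"

text \<open>Isomorphism in the arrow category. It absorbs associators, braidings and the structure
  maps of monoidal functors wherever only the vanishing of an arrow matters.\<close>

definition arrow_iso :: "('o, 'm, 'x) cat_data_scheme \<Rightarrow> 'm \<Rightarrow> 'm \<Rightarrow> bool" where
  "arrow_iso C f g \<longleftrightarrow> (\<exists>a b a' b' u v. f \<in> Hom C a b \<and> g \<in> Hom C a' b' \<and>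
     u \<in> isos C a a' \<and> v \<in> isos C b b' \<and> v \<cdot>\<^bsub>C\<^esub> f = g \<cdot>\<^bsub>C\<^esub> u)"

context category
begin

lemma isomorphic_refl: "a \<in> Ob C \<Longrightarrow> isomorphic C a a"
  unfolding isomorphic_def using isos_Id by blast

lemma isomorphic_sym: "isomorphic C a b \<Longrightarrow> isomorphic C b a"
  unfolding isomorphic_def using isos_sym by blast

lemma isomorphic_trans: "isomorphic C a b \<Longrightarrow> isomorphic C b c \<Longrightarrow> isomorphic C a c"
  unfolding isomorphic_def using isos_Comp by blast

lemma isomorphicI: "f \<in> isos C a b \<Longrightarrow> isomorphic C a b"
  unfolding isomorphic_def by blast

lemma isomorphic_Ob: "isomorphic C a b \<Longrightarrow> a \<in> Ob C \<and> b \<in> Ob C"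
  unfolding isomorphic_def using isos_Hom Hom_Ob by blast

lemma arrow_isoI:
  assumes "f \<in> Hom C a b" "g \<in> Hom C a' b'" "u \<in> isos C a a'" "v \<in> isos C b b'" "v \<cdot> f = g \<cdot> u"
  shows "arrow_iso C f g"
  using assms unfolding arrow_iso_def by blast

lemma arrow_iso_refl: "f \<in> Hom C a b \<Longrightarrow> arrow_iso C f f"
  by (rule arrow_isoI[where u = "Id C a" and v = "Id C b"])
    (use Hom_Ob in \<open>auto simp: Id_left Id_right intro: isos_Id\<close>)

lemma arrow_iso_sym:
  assumes "arrow_iso C f g"
  shows "arrow_iso C g f"
proof -
  obtain a b a' b' u v where f: "f \<in> Hom C a b" and g: "g \<in> Hom C a' b'"
    and u: "u \<in> isos C a a'" and v: "v \<in> isos C b b'" and e: "v \<cdot> f = g \<cdot> u"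
    using assms unfolding arrow_iso_def by blast
  obtain u' where u': "u' \<in> isos C a' a" "u' \<cdot> u = Id C a" "u \<cdot> u' = Id C a'"
    using isos_sym[OF u] by blast
  obtain v' where v': "v' \<in> isos C b' b" "v' \<cdot> v = Id C b" "v \<cdot> v' = Id C b'"
    using isos_sym[OF v] by blast
  note h = isos_Hom[OF u] isos_Hom[OF v] isos_Hom[OF u'(1)] isos_Hom[OF v'(1)]
  have fu': "f \<cdot> u' \<in> Hom C a' b"
    using Comp_Hom h f by blast
  have "v' \<cdot> g = v' \<cdot> (g \<cdot> (u \<cdot> u'))"
    using u'(3) Id_right g by simp
  also have "\<dots> = v' \<cdot> ((g \<cdot> u) \<cdot> u')"
    using Comp_assoc[OF h(3) h(1) g] by simp
  also have "\<dots> = v' \<cdot> (v \<cdot> (f \<cdot> u'))"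
    using e Comp_assoc[OF h(3) f h(2)] by simp
  also have "\<dots> = f \<cdot> u'"
    using v'(2) Comp_assoc[OF fu' h(2) h(4)] Id_left[OF fu'] by simp
  finally show ?thesis
    using g f u'(1) v'(1) by (rule arrow_isoI[rotated 4])
qed

lemma arrow_iso_trans:
  assumes "arrow_iso C f g" "arrow_iso C g h"
  shows "arrow_iso C f h"
proof -
  obtain a b a' b' u v where f: "f \<in> Hom C a b" and g: "g \<in> Hom C a' b'"
    and u: "u \<in> isos C a a'" and v: "v \<in> isos C b b'" and e: "v \<cdot> f = g \<cdot> u"
    using assms unfolding arrow_iso_def by blast
  obtain a1 b1 a'' b'' u' v' where g': "g \<in> Hom C a1 b1" and h: "h \<in> Hom C a'' b''"
    and u': "u' \<in> isos C a1 a''" and v': "v' \<in> isos C b1 b''" and e': "v' \<cdot> g = h \<cdot> u'"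
    using assms unfolding arrow_iso_def by blast
  have [simp]: "a1 = a'" "b1 = b'"
    using g g' by (auto simp: Hom_def)
  note H = isos_Hom[OF u] isos_Hom[OF v] isos_Hom[OF u'] isos_Hom[OF v']
  have "(v' \<cdot> v) \<cdot> f = v' \<cdot> (g \<cdot> u)"
    using Comp_assoc[OF f H(2) H(4)[simplified]] e by simp
  also have "\<dots> = (v' \<cdot> g) \<cdot> u"
    using Comp_assoc[OF H(1) g H(4)[simplified]] by simp
  also have "\<dots> = h \<cdot> (u' \<cdot> u)"
    using Comp_assoc[OF H(1) H(3)[simplified] h] e' by simp
  finally show ?thesis
    using arrow_isoI[OF f h isos_Comp[OF u u'[simplified]] isos_Comp[OF v v'[simplified]]] by blast
qed

text \<open>Lets a statement about arrows specialise to objects through identity arrows; tensor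
  powers of objects are treated this way.\<close>

lemma arrow_iso_Id: "isomorphic C a b \<longleftrightarrow> arrow_iso C (Id C a) (Id C b) \<and> a \<in> Ob C \<and> b \<in> Ob C"
proof
  assume l: "isomorphic C a b"
  then obtain u where u: "u \<in> isos C a b"
    unfolding isomorphic_def by blast
  show "arrow_iso C (Id C a) (Id C b) \<and> a \<in> Ob C \<and> b \<in> Ob C"
    using isomorphic_Ob[OF l] isos_Hom[OF u] u
    by (auto intro!: arrow_isoI[where u = u and v = u] Id_Hom simp: Id_left Id_right)
next
  assume r: "arrow_iso C (Id C a) (Id C b) \<and> a \<in> Ob C \<and> b \<in> Ob C"
  then obtain a1 b1 a' b' u where "Id C a \<in> Hom C a1 b1" "Id C b \<in> Hom C a' b'" "u \<in> isos C a1 a'"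
    unfolding arrow_iso_def by blast
  moreover have "Id C a \<in> Hom C a a" "Id C b \<in> Hom C b b"
    using r Id_Hom by auto
  ultimately show "isomorphic C a b"
    by (auto simp: Hom_def isomorphic_def)
qed

end

context additive_category
begin

lemma Zero_Hom: "a \<in> Ob C \<Longrightarrow> b \<in> Ob C \<Longrightarrow> Zero C a b \<in> Hom C a b"
  using monoid.one_closed[OF comm_monoid.axioms(1)[OF comm_group.axioms(1)[OF hom_comm_group]]]
  by (simp add: hom_group_def)

lemma Plus_Hom: "f \<in> Hom C a b \<Longrightarrow> g \<in> Hom C a b \<Longrightarrow> f \<oplus>\<^sub>A g \<in> Hom C a b"
  using monoid.m_closed[OF comm_monoid.axioms(1)[OF comm_group.axioms(1)[OF hom_comm_group]], of a b f g]
    Hom_Ob[of f a b]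
  by (simp add: hom_group_def)

lemma hom_group_group: "a \<in> Ob C \<Longrightarrow> b \<in> Ob C \<Longrightarrow> group (hom_group C a b)"
  using hom_comm_group comm_group.axioms(2) by blast

lemma Plus_Zero_left: "f \<in> Hom C a b \<Longrightarrow> Zero C a b \<oplus>\<^sub>A f = f"
  using monoid.l_one[OF group.is_monoid[OF hom_group_group], of a b f] Hom_Ob[of f a b]
  by (simp add: hom_group_def)

lemma Plus_Zero_right: "f \<in> Hom C a b \<Longrightarrow> f \<oplus>\<^sub>A Zero C a b = f"
  using monoid.r_one[OF group.is_monoid[OF hom_group_group], of a b f] Hom_Ob[of f a b]
  by (simp add: hom_group_def)

lemma Plus_assoc: "f \<in> Hom C a b \<Longrightarrow> g \<in> Hom C a b \<Longrightarrow> h \<in> Hom C a b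
    \<Longrightarrow> (f \<oplus>\<^sub>A g) \<oplus>\<^sub>A h = f \<oplus>\<^sub>A (g \<oplus>\<^sub>A h)"
  using monoid.m_assoc[OF group.is_monoid[OF hom_group_group], of a b f g h] Hom_Ob[of f a b]
  by (simp add: hom_group_def)

text \<open>Applied to the image of 0 + 0 = 0, this shows that composition and additive functors
  preserve zero arrows.\<close>

lemma Plus_idem_Zero:
  assumes "f \<in> Hom C a b" "f \<oplus>\<^sub>A f = f"
  shows "f = Zero C a b"
  using group.l_cancel_one[OF hom_group_group, of a b f f] Hom_Ob[OF assms(1)] assms
  by (simp add: hom_group_def)

lemma hom_neg_Hom: "f \<in> Hom C a b \<Longrightarrow> hom_neg C f \<in> Hom C a b"
  using group.inv_closed[OF hom_group_group, of a b f] Hom_Ob[of f a b]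
  by (auto simp: hom_neg_def Hom_def hom_group_def)

lemma Plus_hom_neg:
  assumes "f \<in> Hom C a b"
  shows "f \<oplus>\<^sub>A hom_neg C f = Zero C a b"
proof -
  have "Dom C f = a" "Cod C f = b"
    using assms by (auto simp: Hom_def)
  then show ?thesis
    using group.r_inv[OF hom_group_group, of a b f] Hom_Ob[of f a b] assms
    by (simp add: hom_neg_def hom_group_def)
qed

lemma hom_neg_Zero: "a \<in> Ob C \<Longrightarrow> b \<in> Ob C \<Longrightarrow> hom_neg C (Zero C a b) = Zero C a b"
  using Plus_hom_neg[OF Zero_Hom] Plus_Zero_left[OF hom_neg_Hom[OF Zero_Hom]] by metis

lemma Comp_Zero_left:
  assumes f: "f \<in> Hom C a b" and "c \<in> Ob C"
  shows "Zero C b c \<cdot> f = Zero C a c"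
proof -
  have z: "Zero C b c \<in> Hom C b c"
    using assms Hom_Ob Zero_Hom by blast
  show ?thesis
    using Comp_Plus_left[OF f z z] Plus_Zero_left[OF z] Plus_idem_Zero[OF Comp_Hom[OF f z]] by simp
qed

lemma Comp_Zero_right:
  assumes g: "g \<in> Hom C b c" and "a \<in> Ob C"
  shows "g \<cdot> Zero C a b = Zero C a c"
proof -
  have z: "Zero C a b \<in> Hom C a b"
    using assms Hom_Ob Zero_Hom by blast
  show ?thesis
    using Comp_Plus_right[OF z z g] Plus_Zero_left[OF z] Plus_idem_Zero[OF Comp_Hom[OF z g]] by simp
qed

text \<open>Removes the sign that rotating a triangle puts on the shifted map.\<close>

lemma Comp_hom_neg_left:
  assumes f: "f \<in> Hom C a b" and g: "g \<in> Hom C b c" and z: "hom_neg C g \<cdot> f = Zero C a c"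
  shows "g \<cdot> f = Zero C a c"
proof -
  have c: "c \<in> Ob C" and gf: "g \<cdot> f \<in> Hom C a c"
    using Hom_Ob[OF g] Comp_Hom[OF f g] by auto
  have "g \<cdot> f = (g \<cdot> f) \<oplus>\<^sub>A (hom_neg C g \<cdot> f)"
    using Plus_Zero_right[OF gf] z by simp
  also have "\<dots> = Zero C a c"
    using Comp_Plus_left[OF f g hom_neg_Hom[OF g]] Plus_hom_neg[OF g] Comp_Zero_left[OF f c] by simp
  finally show ?thesis .
qed

lemma zero_object_iff: "zero_object C z \<longleftrightarrow> z \<in> Ob C \<and> Id C z = Zero C z z"
proof
  assume "zero_object C z"
  then show "z \<in> Ob C \<and> Id C z = Zero C z z"
    unfolding zero_object_def using Id_Hom Zero_Hom by blast
next
  assume z: "z \<in> Ob C \<and> Id C z = Zero C z z"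
  have 1: "f = Zero C a z" if "f \<in> Hom C a z" for f a
    using Id_left[OF that] z Comp_Zero_left[OF that] by auto
  have 2: "f = Zero C z a" if "f \<in> Hom C z a" for f a
    using Id_right[OF that] z Comp_Zero_right[OF that] by auto
  show "zero_object C z"
    unfolding zero_object_def using z 1 2 Zero_Hom by blast
qed

lemma arrow_iso_Zero:
  assumes "arrow_iso C f g" "f = Zero C (Dom C f) (Cod C f)"
  shows "g = Zero C (Dom C g) (Cod C g)"
proof -
  obtain a b a' b' u v where f: "f \<in> Hom C a b" and g: "g \<in> Hom C a' b'"
    and u: "u \<in> isos C a a'" and v: "v \<in> isos C b b'" and e: "v \<cdot> f = g \<cdot> u"
    using assms(1) unfolding arrow_iso_def by blast
  obtain u' where u': "u' \<in> isos C a' a" "u \<cdot> u' = Id C a'"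
    using isos_sym[OF u] by blast
  have D: "Dom C f = a" "Cod C f = b" "Dom C g = a'" "Cod C g = b'"
    using f g by (auto simp: Hom_def)
  note H = isos_Hom[OF u] isos_Hom[OF v] isos_Hom[OF u'(1)]
  have "g = (g \<cdot> u) \<cdot> u'"
    using Comp_assoc[OF H(3) H(1) g] u'(2) Id_right[OF g] by simp
  also have "\<dots> = (v \<cdot> Zero C a b) \<cdot> u'"
    using e assms(2) D by simp
  also have "\<dots> = Zero C a' b'"
    using Comp_Zero_right[OF H(2)] Comp_Zero_left[OF H(3)] Hom_Ob[OF H(1)] Hom_Ob[OF H(2)] by simp
  finally show ?thesis
    using D by simp
qed

end

section \<open>Images of isomorphisms, zero objects and biproducts under functors\<close>

lemma is_functor_isos:
  assumes "category C" "category D" "is_functor C D Fo Fa" "u \<in> isos C a b"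
  shows "Fa u \<in> isos D (Fo a) (Fo b)"
proof -
  interpret C: category C by fact
  interpret D: category D by fact
  obtain v where v: "u \<in> Hom C a b" "v \<in> Hom C b a" "v \<cdot>\<^bsub>C\<^esub> u = Id C a" "u \<cdot>\<^bsub>C\<^esub> v = Id C b"
    using assms(4) by (rule C.isosE)
  have "Fa u \<in> Hom D (Fo a) (Fo b)" "Fa v \<in> Hom D (Fo b) (Fo a)"
    using assms(3) v unfolding is_functor_def by blast+
  moreover have "Fa v \<cdot>\<^bsub>D\<^esub> Fa u = Id D (Fo a)" "Fa u \<cdot>\<^bsub>D\<^esub> Fa v = Id D (Fo b)"
    using assms(3) v C.Hom_Ob[OF v(1)] unfolding is_functor_def by metis+
  ultimately show ?thesis
    by (rule D.isosI)
qed

lemma is_functor_isomorphic: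
  assumes "category C" "category D" "is_functor C D Fo Fa" "isomorphic C a b"
  shows "isomorphic D (Fo a) (Fo b)"
  using is_functor_isos[OF assms(1-3)] assms(4) unfolding isomorphic_def by blast

lemma additive_functor_Zero:
  assumes "additive_category C" "additive_category D" "additive_functor C D Fo Fa"
    and "a \<in> Ob C" "b \<in> Ob C"
  shows "Fa (Zero C a b) = Zero D (Fo a) (Fo b)"
proof -
  interpret C: additive_category C by fact
  interpret D: additive_category D by fact
  have z: "Zero C a b \<in> Hom C a b"
    using C.Zero_Hom assms by blast
  have "Fa (Zero C a b) \<in> Hom D (Fo a) (Fo b)"
    using assms(3) z unfolding additive_functor_def is_functor_def by blast
  moreover have "Fa (Zero C a b) \<oplus>\<^sub>A\<^bsub>D\<^esub> Fa (Zero C a b) = Fa (Zero C a b)"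
    using assms(3) z C.Plus_Zero_left[OF z] unfolding additive_functor_def by metis
  ultimately show ?thesis
    by (rule D.Plus_idem_Zero)
qed

lemma additive_functor_zero_object:
  assumes "additive_category C" "additive_category D" "additive_functor C D Fo Fa" "zero_object C z"
  shows "zero_object D (Fo z)"
proof -
  interpret C: additive_category C by fact
  interpret D: additive_category D by fact
  have z: "z \<in> Ob C" "Id C z = Zero C z z"
    using assms(4) C.zero_object_iff by auto
  have "Fa (Id C z) = Id D (Fo z)" "Fo z \<in> Ob D"
    using assms(3) z unfolding additive_functor_def is_functor_def by blast+
  then show ?thesis
    using D.zero_object_iff z additive_functor_Zero[OF assms(1-3) z(1) z(1)] by simp
qed

lemma additive_functor_is_biproduct:
  assumes "additive_category C" "additive_category D" "additive_functor C D Fo Fa"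
    and "is_biproduct C a b s"
  shows "is_biproduct D (Fo a) (Fo b) (Fo s)"
proof -
  interpret C: additive_category C by fact
  interpret D: additive_category D by fact
  obtain i j p q where h: "i \<in> Hom C a s" "j \<in> Hom C b s" "p \<in> Hom C s a" "q \<in> Hom C s b"
    and e: "p \<cdot>\<^bsub>C\<^esub> i = Id C a" "q \<cdot>\<^bsub>C\<^esub> j = Id C b" "q \<cdot>\<^bsub>C\<^esub> i = Zero C a b" "p \<cdot>\<^bsub>C\<^esub> j = Zero C b a"
      "(i \<cdot>\<^bsub>C\<^esub> p) \<oplus>\<^sub>A\<^bsub>C\<^esub> (j \<cdot>\<^bsub>C\<^esub> q) = Id C s"
    using assms(4) unfolding is_biproduct_def by blast
  have o: "a \<in> Ob C" "b \<in> Ob C" "s \<in> Ob C"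
    using C.Hom_Ob h by blast+
  have comp: "Fa (g \<cdot>\<^bsub>C\<^esub> f) = Fa g \<cdot>\<^bsub>D\<^esub> Fa f" if "f \<in> Hom C x y" "g \<in> Hom C y z" for f g x y z
    using assms(3) that unfolding additive_functor_def is_functor_def by blast
  have add: "Fa (f \<oplus>\<^sub>A\<^bsub>C\<^esub> g) = Fa f \<oplus>\<^sub>A\<^bsub>D\<^esub> Fa g" if "f \<in> Hom C x y" "g \<in> Hom C x y" for f g x y
    using assms(3) that unfolding additive_functor_def by blast
  have Id: "Fa (Id C x) = Id D (Fo x)" if "x \<in> Ob C" for x
    using assms(3) that unfolding additive_functor_def is_functor_def by blast
  have H: "Fa f \<in> Hom D (Fo x) (Fo y)" if "f \<in> Hom C x y" for f x y
    using assms(3) that unfolding additive_functor_def is_functor_def by blast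
  note Z = additive_functor_Zero[OF assms(1-3)]
  have "(Fa i \<cdot>\<^bsub>D\<^esub> Fa p) \<oplus>\<^sub>A\<^bsub>D\<^esub> (Fa j \<cdot>\<^bsub>D\<^esub> Fa q) = Id D (Fo s)"
    using add[OF C.Comp_Hom[OF h(3,1)] C.Comp_Hom[OF h(4,2)]] comp[OF h(3,1)] comp[OF h(4,2)]
      e(5) Id[OF o(3)] by simp
  moreover have "Fa p \<cdot>\<^bsub>D\<^esub> Fa i = Id D (Fo a)" "Fa q \<cdot>\<^bsub>D\<^esub> Fa j = Id D (Fo b)"
    "Fa q \<cdot>\<^bsub>D\<^esub> Fa i = Zero D (Fo a) (Fo b)" "Fa p \<cdot>\<^bsub>D\<^esub> Fa j = Zero D (Fo b) (Fo a)"
    using comp[OF h(1,3)] comp[OF h(2,4)] comp[OF h(1,4)] comp[OF h(2,3)] e Id o Z by simp_all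
  ultimately show ?thesis
    unfolding is_biproduct_def using H h by blast
qed

section \<open>Triangulated categories\<close>

context triangulated_category
begin

lemma dist_triangle_Hom:
  assumes "dist_triangle C a b c f g h"
  shows "f \<in> Hom C a b" "g \<in> Hom C b c" "h \<in> Hom C c (ShiftO C a)"
  using assms by (auto simp: dist_triangle_def triangle_shape_def)

lemma ShiftO_Ob: "a \<in> Ob C \<Longrightarrow> ShiftO C a \<in> Ob C"
  using shift_additive by (auto simp: additive_functor_def is_functor_def)

lemma ShiftA_Hom: "f \<in> Hom C a b \<Longrightarrow> ShiftA C f \<in> Hom C (ShiftO C a) (ShiftO C b)"
  using shift_additive by (auto simp: additive_functor_def is_functor_def)

lemma ShiftA_Zero: "a \<in> Ob C \<Longrightarrow> b \<in> Ob C \<Longrightarrow> ShiftA C (Zero C a b) = Zero C (ShiftO C a) (ShiftO C b)"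
  using additive_functor_Zero[OF additive_category_axioms additive_category_axioms shift_additive] .

lemma zero_object_ShiftO: "zero_object C z \<Longrightarrow> zero_object C (ShiftO C z)"
  using additive_functor_zero_object[OF additive_category_axioms additive_category_axioms shift_additive] .

lemma isomorphic_ShiftO: "isomorphic C a b \<Longrightarrow> isomorphic C (ShiftO C a) (ShiftO C b)"
  using is_functor_isomorphic[OF category_axioms category_axioms] shift_additive
  unfolding additive_functor_def by blast

lemma dist_triangle_rotate:
  "dist_triangle C a b c f g h \<Longrightarrow> dist_triangle C b c (ShiftO C a) g h (hom_neg C (ShiftA C f))"
  using Tri_rotate by (metis dist_triangle_def)

text \<open>Map the triangle of \<open>Id C a\<close> to the given one by \<open>Id C a\<close> and
  \<open>f\<close>; the third component of this morphism factors \<open>g \<cdot> f\<close> through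
  a zero object.\<close>

lemma dist_triangle_Comp:
  assumes t: "dist_triangle C a b c f g h"
  shows "g \<cdot> f = Zero C a c"
proof -
  note H = dist_triangle_Hom[OF t]
  obtain z where z: "zero_object C z"
    using ex_zero_object by blast
  obtain w where w: "w \<in> Hom C z c" "w \<cdot> Zero C a z = g \<cdot> f"
    using Tri_morphism[OF Tri_id[OF _ z] t Id_Hom H(1)] Hom_Ob[OF H(1)] by blast
  then show ?thesis
    using Comp_Zero_right[OF w(1)] Hom_Ob[OF H(1)] by simp
qed

text \<open>The identity triangle of \<open>y\<close> with zero object \<open>ShiftO C z\<close>,
  rotated backwards; the sign disappears because the shifted map is zero.\<close>

lemma dist_triangle_from_zero:
  assumes z: "zero_object C z" and y: "y \<in> Ob C"
  shows "dist_triangle C z y y (Zero C z y) (Id C y) (Zero C y (ShiftO C z))"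
proof -
  have zO: "z \<in> Ob C"
    using z zero_object_iff by blast
  have "triangle_shape C z y y (Zero C z y) (Id C y) (Zero C y (ShiftO C z))"
    unfolding triangle_shape_def using zO y Zero_Hom Id_Hom ShiftO_Ob by blast
  moreover have "dist_triangle C y y (ShiftO C z) (Id C y) (Zero C y (ShiftO C z))
      (hom_neg C (ShiftA C (Zero C z y)))"
    using Tri_id[OF y zero_object_ShiftO[OF z]] ShiftA_Zero[OF zO y]
      hom_neg_Zero[OF ShiftO_Ob[OF zO] ShiftO_Ob[OF y]] by simp
  ultimately show ?thesis
    using Tri_rotate by blast
qed

text \<open>The third component of a morphism into the triangle 0 -> y -> y is the required
  factorisation. With \<open>dist_triangle_Comp\<close> this replaces the long exact Hom
  sequences.\<close>

lemma weak_cokernel: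
  assumes t: "dist_triangle C a b c f g h" and x: "x \<in> Hom C b y" "x \<cdot> f = Zero C a y"
  shows "\<exists>w\<in>Hom C c y. w \<cdot> g = x"
proof -
  note H = dist_triangle_Hom[OF t]
  obtain z where z: "zero_object C z"
    using ex_zero_object by blast
  then have zO: "z \<in> Ob C"
    using zero_object_iff by blast
  have O: "a \<in> Ob C" "y \<in> Ob C"
    using H x Hom_Ob by blast+
  have Z: "Zero C a z \<in> Hom C a z" "Zero C z y \<in> Hom C z y"
    using Zero_Hom zO O by blast+
  have "x \<cdot> f = Zero C z y \<cdot> Zero C a z"
    using x(2) Comp_Zero_left[OF Z(1) O(2)] by simp
  then obtain w where "w \<in> Hom C c y" "w \<cdot> g = Id C y \<cdot> x"
    using Tri_morphism[OF t dist_triangle_from_zero[OF z O(2)] Z(1) x(1)] by blast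
  then show ?thesis
    using Id_left[OF x(1)] by auto
qed

text \<open>Since the first map vanishes, \<open>Id C b\<close> extends along \<open>g\<close> to a
  retraction \<open>q\<close>. The complementary idempotent 1 - g q kills \<open>g\<close>, hence
  factors through \<open>h\<close> as p h. The remaining identities are checked after composing with
  \<open>h\<close>, which can be cancelled.\<close>

lemma dist_triangle_zero_splits:
  assumes t: "dist_triangle C a b c (Zero C a b) g h"
  shows "is_biproduct C b (ShiftO C a) c"
proof -
  let ?a = "ShiftO C a"
  note t1 = dist_triangle_rotate[OF t]
  note t2 = dist_triangle_rotate[OF t1]
  note H = dist_triangle_Hom[OF t]
  have O: "a \<in> Ob C" "b \<in> Ob C" "c \<in> Ob C" "?a \<in> Ob C"
    using Hom_Ob H by blast+
  note I = Id_Hom[OF O(2)] Id_Hom[OF O(3)] Id_Hom[OF O(4)]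
  have n0: "hom_neg C (ShiftA C (Zero C a b)) = Zero C ?a (ShiftO C b)"
    using O by (simp add: ShiftA_Zero hom_neg_Zero ShiftO_Ob)
  \<comment> \<open>In the rotated triangle the map following \<open>h\<close> is the negated shift
    of a zero map, so an arrow killed by \<open>h\<close> factors through zero.\<close>
  have epi: "x = Zero C ?a y" if x: "x \<in> Hom C ?a y" "x \<cdot> h = Zero C c y" for x y
  proof -
    obtain r where r: "r \<in> Hom C (ShiftO C b) y" "r \<cdot> Zero C ?a (ShiftO C b) = x"
      using weak_cokernel[OF t2 x] n0 by auto
    then show ?thesis
      using Comp_Zero_right[OF r(1)] O by simp
  qed
  have hg: "h \<cdot> g = Zero C b ?a"
    using dist_triangle_Comp[OF t1] .
  obtain q where q: "q \<in> Hom C c b" "q \<cdot> g = Id C b"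
    using weak_cokernel[OF t I(1)] Comp_Zero_right[OF I(1)] O by auto
  define n where "n = hom_neg C (g \<cdot> q)"
  have gq: "g \<cdot> q \<in> Hom C c c"
    using q H Comp_Hom by blast
  have n: "n \<in> Hom C c c" "(g \<cdot> q) \<oplus>\<^sub>A n = Zero C c c"
    unfolding n_def using gq hom_neg_Hom Plus_hom_neg by auto
  \<comment> \<open>This is 1 - g q; subtraction is written as adding \<open>n\<close>.\<close>
  define e where "e = Id C c \<oplus>\<^sub>A n"
  have e: "e \<in> Hom C c c"
    unfolding e_def using I n Plus_Hom by blast
  have gqg: "(g \<cdot> q) \<cdot> g = g" "q \<cdot> (g \<cdot> q) = q"
    using Comp_assoc[OF H(2) q(1) H(2)] Comp_assoc[OF q(1) H(2) q(1)] q Id_right[OF H(2)]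
      Id_left[OF q(1)] by auto
  have "e \<cdot> g = ((g \<cdot> q) \<oplus>\<^sub>A n) \<cdot> g"
    unfolding e_def using Comp_Plus_left[OF H(2) gq n(1)] Comp_Plus_left[OF H(2) I(2) n(1)]
      gqg Id_left[OF H(2)] by simp
  then have eg: "e \<cdot> g = Zero C b c"
    using n Comp_Zero_left[OF H(2) O(3)] by simp
  have "q \<cdot> e = q \<cdot> ((g \<cdot> q) \<oplus>\<^sub>A n)"
    unfolding e_def using Comp_Plus_right[OF gq n(1) q(1)] Comp_Plus_right[OF I(2) n(1) q(1)]
      gqg Id_right[OF q(1)] by simp
  then have qe: "q \<cdot> e = Zero C c b"
    using n Comp_Zero_right[OF q(1) O(3)] by simp
  obtain p where p: "p \<in> Hom C ?a c" "p \<cdot> h = e"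
    using weak_cokernel[OF t1 e eg] by blast
  have "q \<cdot> p = Zero C ?a b"
    using epi[OF Comp_Hom[OF p(1) q(1)]] Comp_assoc[OF H(3) p(1) q(1)] p(2) qe by simp
  moreover have "(g \<cdot> q) \<oplus>\<^sub>A (p \<cdot> h) = Id C c"
  proof -
    have comm: "x \<oplus>\<^sub>A y = y \<oplus>\<^sub>A x" if "x \<in> Hom C c c" "y \<in> Hom C c c" for x y
      using comm_monoid.m_comm[OF comm_group.axioms(1)[OF hom_comm_group[OF O(3) O(3)]]] that
      by (simp add: hom_group_def)
    show ?thesis
      unfolding p(2) e_def using comm[OF I(2) n(1)] Plus_assoc[OF gq n(1) I(2)] n(2)
        Plus_Zero_left[OF I(2)] by simp
  qed
  \<comment> \<open>From h e = h and e = p h it follows that (h p - 1) h = 0, and \<open>epi\<close>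
    cancels \<open>h\<close>.\<close>
  moreover have "h \<cdot> p = Id C ?a"
  proof -
    let ?m = "hom_neg C (Id C ?a)"
    have m: "?m \<in> Hom C ?a ?a" "Id C ?a \<oplus>\<^sub>A ?m = Zero C ?a ?a"
      using hom_neg_Hom Plus_hom_neg I by auto
    have hp: "h \<cdot> p \<in> Hom C ?a ?a"
      using Comp_Hom p H by blast
    have "h \<cdot> n = Zero C c ?a"
    proof -
      have hgq: "h \<cdot> (g \<cdot> q) = Zero C c ?a"
        using Comp_assoc[OF q(1) H(2) H(3)] hg Comp_Zero_left[OF q(1) O(4)] by simp
      have "h \<cdot> n = h \<cdot> (g \<cdot> q) \<oplus>\<^sub>A h \<cdot> n"
        using hgq Plus_Zero_left[OF Comp_Hom[OF n(1) H(3)]] by simp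
      also have "\<dots> = h \<cdot> Zero C c c"
        using Comp_Plus_right[OF gq n(1) H(3)] n(2) by simp
      finally show ?thesis
        using Comp_Zero_right[OF H(3) O(3)] by simp
    qed
    then have "h \<cdot> e = h"
      unfolding e_def using Comp_Plus_right[OF I(2) n(1) H(3)] Id_right[OF H(3)]
        Plus_Zero_right[OF H(3)] by simp
    then have "((h \<cdot> p) \<oplus>\<^sub>A ?m) \<cdot> h = (Id C ?a \<oplus>\<^sub>A ?m) \<cdot> h"
      using Comp_Plus_left[OF H(3) hp m(1)] Comp_Plus_left[OF H(3) I(3) m(1)]
        Comp_assoc[OF H(3) p(1) H(3)] p(2) Id_left[OF H(3)] by simp
    then have "((h \<cdot> p) \<oplus>\<^sub>A ?m) \<cdot> h = Zero C c ?a"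
      using m(2) Comp_Zero_left[OF H(3) O(4)] by simp
    then have "(h \<cdot> p) \<oplus>\<^sub>A ?m = Zero C ?a ?a"
      using epi[OF Plus_Hom[OF hp m(1)]] by blast
    then have "(h \<cdot> p) \<oplus>\<^sub>A ?m = Id C ?a \<oplus>\<^sub>A ?m"
      using m(2) by simp
    then show ?thesis
      using group.right_cancel[OF hom_group_group[OF O(4) O(4)], of ?m "h \<cdot> p" "Id C ?a"] hp m(1) I(3)
      by (simp add: hom_group_def)
  qed
  ultimately show ?thesis
    unfolding is_biproduct_def using H q p hg by blast
qed

text \<open>The cone of the zero map a -> b serves as a direct sum of b and a shift of a.\<close>

lemma thick_zero_cone_iff:
  assumes J: "thick_subcategory C J" and t: "dist_triangle C a b c (Zero C a b) g h"
  shows "c \<in> J \<longleftrightarrow> a \<in> J \<and> b \<in> J"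
proof -
  have O: "a \<in> Ob C" "b \<in> Ob C"
    using dist_triangle_Hom[OF t] Hom_Ob by blast+
  have "b \<in> J \<and> ShiftO C a \<in> J" if "c \<in> J"
    using that J dist_triangle_zero_splits[OF t] O ShiftO_Ob unfolding thick_subcategory_def by blast
  then show ?thesis
    using J t O unfolding thick_subcategory_def by blast
qed

end

text \<open>Serves two purposes: for tensoring with an object it yields ideal quotients, for a
  tt-functor it yields the map on spectra.\<close>

lemma thick_subcategory_preimage:
  assumes "triangulated_category C" "triangulated_category D" "exact_functor C D Fo Fa \<theta>"
    and J: "thick_subcategory D J"
  shows "thick_subcategory C {a \<in> Ob C. Fo a \<in> J}"
proof -
  interpret C: triangulated_category C by fact
  interpret D: triangulated_category D by fact
  have add: "additive_functor C D Fo Fa"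
    using assms(3) unfolding exact_functor_def by blast
  then have fn: "is_functor C D Fo Fa"
    unfolding additive_functor_def by blast
  have O: "Fo a \<in> Ob D" if "a \<in> Ob C" for a
    using fn that unfolding is_functor_def by blast
  have iso: "b \<in> J" if "a \<in> J" "isomorphic D a b" for a b
    using J that D.isomorphic_Ob[OF that(2)] unfolding thick_subcategory_def isomorphic_def by blast
  have sh: "isomorphic D (Fo (ShiftO C a)) (ShiftO D (Fo a))" if "a \<in> Ob C" for a
    using assms(3) that unfolding exact_functor_def natural_iso_def isomorphic_def by blast
  note add' = C.additive_category_axioms D.additive_category_axioms add
  show ?thesis
    unfolding thick_subcategory_def
  proof (intro conjI allI ballI impI)
    fix z assume z: "zero_object C z"
    then show "z \<in> {a \<in> Ob C. Fo a \<in> J}"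
      using additive_functor_zero_object[OF add'] J C.zero_object_iff
      unfolding thick_subcategory_def by blast
  next
    fix a b assume "a \<in> {a \<in> Ob C. Fo a \<in> J}" "b \<in> Ob C" "isos C a b \<noteq> {}"
    then show "b \<in> {a \<in> Ob C. Fo a \<in> J}"
      using iso is_functor_isomorphic[OF C.category_axioms D.category_axioms fn]
      unfolding isomorphic_def by blast
  next
    fix a assume a: "a \<in> Ob C"
    have "Fo a \<in> J \<longleftrightarrow> ShiftO D (Fo a) \<in> J"
      using J O[OF a] unfolding thick_subcategory_def by blast
    also have "\<dots> \<longleftrightarrow> Fo (ShiftO C a) \<in> J"
      using iso sh[OF a] D.isomorphic_sym by blast
    finally show "(a \<in> {a \<in> Ob C. Fo a \<in> J}) = (ShiftO C a \<in> {a \<in> Ob C. Fo a \<in> J})"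
      using a C.ShiftO_Ob by blast
  next
    fix a b c f g h assume t: "dist_triangle C a b c f g h"
    then have "dist_triangle D (Fo a) (Fo b) (Fo c) (Fa f) (Fa g) (\<theta> a \<cdot>\<^bsub>D\<^esub> Fa h)"
      using assms(3) unfolding exact_functor_def by blast
    then have r: "(Fo a \<in> J \<and> Fo b \<in> J \<longrightarrow> Fo c \<in> J) \<and> (Fo b \<in> J \<and> Fo c \<in> J \<longrightarrow> Fo a \<in> J) \<and>
        (Fo a \<in> J \<and> Fo c \<in> J \<longrightarrow> Fo b \<in> J)"
      using J unfolding thick_subcategory_def by blast
    have "a \<in> Ob C" "b \<in> Ob C" "c \<in> Ob C"
      using C.dist_triangle_Hom[OF t] C.Hom_Ob by blast+
    then show "a \<in> {a \<in> Ob C. Fo a \<in> J} \<and> b \<in> {a \<in> Ob C. Fo a \<in> J} \<Longrightarrow> c \<in> {a \<in> Ob C. Fo a \<in> J}"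
      "b \<in> {a \<in> Ob C. Fo a \<in> J} \<and> c \<in> {a \<in> Ob C. Fo a \<in> J} \<Longrightarrow> a \<in> {a \<in> Ob C. Fo a \<in> J}"
      "a \<in> {a \<in> Ob C. Fo a \<in> J} \<and> c \<in> {a \<in> Ob C. Fo a \<in> J} \<Longrightarrow> b \<in> {a \<in> Ob C. Fo a \<in> J}"
      using r by blast+
  next
    fix a b s assume "a \<in> Ob C" "b \<in> Ob C" "s \<in> {a \<in> Ob C. Fo a \<in> J}" "is_biproduct C a b s"
    then have "Fo a \<in> J \<and> Fo b \<in> J"
      using J O additive_functor_is_biproduct[OF add'] unfolding thick_subcategory_def by blast
    then show "a \<in> {a \<in> Ob C. Fo a \<in> J}" "b \<in> {a \<in> Ob C. Fo a \<in> J}"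
      using \<open>a \<in> Ob C\<close> \<open>b \<in> Ob C\<close> by blast+
  qed blast
qed

section \<open>Tensor powers\<close>

context symmetric_monoidal_category
begin

lemma isos_TensA:
  assumes "u \<in> isos K a b" "v \<in> isos K c d"
  shows "u \<otimes>\<^sub>A v \<in> isos K (a \<otimes>\<^sub>O c) (b \<otimes>\<^sub>O d)"
proof -
  obtain u' where u: "u \<in> Hom K a b" "u' \<in> Hom K b a" "u' \<cdot> u = Id K a" "u \<cdot> u' = Id K b"
    using assms(1) by (rule isosE)
  obtain v' where v: "v \<in> Hom K c d" "v' \<in> Hom K d c" "v' \<cdot> v = Id K c" "v \<cdot> v' = Id K d"
    using assms(2) by (rule isosE)
  have O: "a \<in> Ob K" "b \<in> Ob K" "c \<in> Ob K" "d \<in> Ob K"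
    using u v Hom_Ob by blast+
  show ?thesis
    using u v O TensA_Comp[OF u(1,2) v(1,2)] TensA_Comp[OF u(2,1) v(2,1)]
    by (intro isosI[where g = "u' \<otimes>\<^sub>A v'"] TensA_Hom) (simp_all add: TensA_Id)
qed

lemma isomorphic_TensO:
  "isomorphic K a b \<Longrightarrow> isomorphic K c d \<Longrightarrow> isomorphic K (a \<otimes>\<^sub>O c) (b \<otimes>\<^sub>O d)"
  unfolding isomorphic_def using isos_TensA by blast

lemma arrow_iso_TensA:
  assumes "arrow_iso K f f'" "arrow_iso K g g'"
  shows "arrow_iso K (f \<otimes>\<^sub>A g) (f' \<otimes>\<^sub>A g')"
proof -
  obtain a b a' b' u v where f: "f \<in> Hom K a b" "f' \<in> Hom K a' b'"
    and u: "u \<in> isos K a a'" "v \<in> isos K b b'" "v \<cdot> f = f' \<cdot> u"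
    using assms(1) unfolding arrow_iso_def by blast
  obtain c d c' d' w x where g: "g \<in> Hom K c d" "g' \<in> Hom K c' d'"
    and w: "w \<in> isos K c c'" "x \<in> isos K d d'" "x \<cdot> g = g' \<cdot> w"
    using assms(2) unfolding arrow_iso_def by blast
  have "(v \<otimes>\<^sub>A x) \<cdot> (f \<otimes>\<^sub>A g) = (v \<cdot> f) \<otimes>\<^sub>A (x \<cdot> g)"
    using TensA_Comp[OF f(1) isos_Hom[OF u(2)] g(1) isos_Hom[OF w(2)]] by simp
  also have "\<dots> = (f' \<otimes>\<^sub>A g') \<cdot> (u \<otimes>\<^sub>A w)"
    using TensA_Comp[OF isos_Hom[OF u(1)] f(2) isos_Hom[OF w(1)] g(2)] u w by simp
  finally show ?thesis
    by (rule arrow_isoI[OF TensA_Hom[OF f(1) g(1)] TensA_Hom[OF f(2) g(2)]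
        isos_TensA[OF u(1) w(1)] isos_TensA[OF u(2) w(2)]])
qed

lemma arrow_iso_Assoc:
  assumes "f \<in> Hom K a a'" "g \<in> Hom K b b'" "h \<in> Hom K c c'"
  shows "arrow_iso K ((f \<otimes>\<^sub>A g) \<otimes>\<^sub>A h) (f \<otimes>\<^sub>A (g \<otimes>\<^sub>A h))"
proof -
  have O: "a \<in> Ob K" "b \<in> Ob K" "c \<in> Ob K" "a' \<in> Ob K" "b' \<in> Ob K" "c' \<in> Ob K"
    using assms Hom_Ob by blast+
  show ?thesis
    by (rule arrow_isoI[OF TensA_Hom[OF TensA_Hom[OF assms(1,2)] assms(3)] TensA_Hom[OF assms(1) TensA_Hom[OF assms(2,3)]] Assoc_iso[OF O(1-3)] Assoc_iso[OF O(4-6)] Assoc_natural[OF assms]])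
qed

lemma arrow_iso_Braid:
  assumes "f \<in> Hom K a a'" "g \<in> Hom K b b'"
  shows "arrow_iso K (f \<otimes>\<^sub>A g) (g \<otimes>\<^sub>A f)"
proof -
  have O: "a \<in> Ob K" "b \<in> Ob K" "a' \<in> Ob K" "b' \<in> Ob K"
    using assms Hom_Ob by blast+
  show ?thesis
    by (rule arrow_isoI[OF TensA_Hom[OF assms] TensA_Hom[OF assms(2,1)] Braid_iso[OF O(1,2)] Braid_iso[OF O(3,4)] Braid_natural[OF assms]])
qed

lemma arrow_iso_RUnit:
  assumes "f \<in> Hom K a b"
  shows "arrow_iso K (f \<otimes>\<^sub>A Id K (Unit K)) f"
proof -
  have O: "a \<in> Ob K" "b \<in> Ob K"
    using assms Hom_Ob by blast+
  show ?thesis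
    by (rule arrow_isoI[OF TensA_Hom[OF assms Id_Hom[OF Unit_Ob]] assms RUnit_iso[OF O(1)] RUnit_iso[OF O(2)] RUnit_natural[OF assms]])
qed

lemma isomorphic_Assoc:
  "a \<in> Ob K \<Longrightarrow> b \<in> Ob K \<Longrightarrow> c \<in> Ob K \<Longrightarrow> isomorphic K ((a \<otimes>\<^sub>O b) \<otimes>\<^sub>O c) (a \<otimes>\<^sub>O (b \<otimes>\<^sub>O c))"
  using Assoc_iso isomorphicI by blast

lemma isomorphic_Braid: "a \<in> Ob K \<Longrightarrow> b \<in> Ob K \<Longrightarrow> isomorphic K (a \<otimes>\<^sub>O b) (b \<otimes>\<^sub>O a)"
  using Braid_iso isomorphicI by blast

lemma isomorphic_RUnit: "a \<in> Ob K \<Longrightarrow> isomorphic K (a \<otimes>\<^sub>O Unit K) a"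
  using RUnit_iso isomorphicI by blast

lemma isomorphic_LUnit: "a \<in> Ob K \<Longrightarrow> isomorphic K (Unit K \<otimes>\<^sub>O a) a"
  using LUnit_iso isomorphicI by blast

lemma isomorphic_left_Comm:
  assumes "a \<in> Ob K" "b \<in> Ob K" "c \<in> Ob K"
  shows "isomorphic K (a \<otimes>\<^sub>O (b \<otimes>\<^sub>O c)) (b \<otimes>\<^sub>O (a \<otimes>\<^sub>O c))"
  using isomorphic_trans[OF isomorphic_sym[OF isomorphic_Assoc[OF assms]]
      isomorphic_trans[OF isomorphic_TensO[OF isomorphic_Braid[OF assms(1,2)] isomorphic_refl[OF assms(3)]]
        isomorphic_Assoc[OF assms(2,1,3)]]] .

lemma tensor_power_ob_Ob: "a \<in> Ob K \<Longrightarrow> tensor_power_ob K a s \<in> Ob K"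
  by (induction s) (auto simp: Unit_Ob TensO_Ob)

lemma tensor_power_ar_Hom:
  "f \<in> Hom K a b \<Longrightarrow> tensor_power_ar K f s \<in> Hom K (tensor_power_ob K a s) (tensor_power_ob K b s)"
  by (induction s) (auto simp: Unit_Ob Id_Hom TensA_Hom)

lemma tensor_power_ar_Id:
  "a \<in> Ob K \<Longrightarrow> tensor_power_ar K (Id K a) s = Id K (tensor_power_ob K a s)"
  by (induction s) (auto simp: TensA_Id tensor_power_ob_Ob)

text \<open>Powers are bracketed to the left and start at the unit, so exponents add only up to
  unitor and associators.\<close>

lemma arrow_iso_tensor_power_add:
  assumes f: "f \<in> Hom K a b"
  shows "arrow_iso K (tensor_power_ar K f s \<otimes>\<^sub>A tensor_power_ar K f t) (tensor_power_ar K f (s + t))"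
proof (induction t)
  case 0
  show ?case
    using arrow_iso_RUnit[OF tensor_power_ar_Hom[OF f]] by simp
next
  case (Suc t)
  note H = tensor_power_ar_Hom[OF f]
  show ?case
    using arrow_iso_trans[OF arrow_iso_sym[OF arrow_iso_Assoc[OF H H f]]
        arrow_iso_TensA[OF Suc arrow_iso_refl[OF f]]] by simp
qed

lemma isomorphic_tensor_power_add:
  "a \<in> Ob K \<Longrightarrow> isomorphic K (tensor_power_ob K a s \<otimes>\<^sub>O tensor_power_ob K a t) (tensor_power_ob K a (s + t))"
  using arrow_iso_tensor_power_add[OF Id_Hom]
  by (simp add: arrow_iso_Id tensor_power_ar_Id tensor_power_ob_Ob TensA_Id TensO_Ob)

end

section \<open>Tensor ideals and primes\<close>

context tt_category
begin

lemma tensor_left_additive: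
  "a \<in> Ob K \<Longrightarrow> additive_functor K K (\<lambda>x. x \<otimes>\<^sub>O a) (\<lambda>f. f \<otimes>\<^sub>A Id K a)"
  using tensor_exact_left unfolding exact_functor_def by blast

lemma tensor_right_additive:
  "a \<in> Ob K \<Longrightarrow> additive_functor K K (\<lambda>x. a \<otimes>\<^sub>O x) (\<lambda>f. Id K a \<otimes>\<^sub>A f)"
  using tensor_exact_right unfolding exact_functor_def by blast

lemma isomorphic_ShiftO_TensO_right:
  assumes "a \<in> Ob K" "b \<in> Ob K"
  shows "isomorphic K (a \<otimes>\<^sub>O ShiftO K b) (ShiftO K (a \<otimes>\<^sub>O b))"
  using tensor_exact_right[OF assms(1)] assms(2)
  unfolding exact_functor_def natural_iso_def isomorphic_def by blast

lemma isomorphic_ShiftO_TensO_left: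
  assumes "a \<in> Ob K" "b \<in> Ob K"
  shows "isomorphic K (ShiftO K b \<otimes>\<^sub>O a) (ShiftO K (b \<otimes>\<^sub>O a))"
  using tensor_exact_left[OF assms(1)] assms(2)
  unfolding exact_functor_def natural_iso_def isomorphic_def by blast

lemma isomorphic_shift_Unit_TensO:
  assumes "a \<in> Ob K"
  shows "isomorphic K (ShiftO K (Unit K) \<otimes>\<^sub>O a) (ShiftO K a)"
  using isomorphic_trans[OF isomorphic_ShiftO_TensO_left[OF assms Unit_Ob]
      isomorphic_ShiftO[OF isomorphic_LUnit[OF assms]]] .

text \<open>Essential surjectivity of the shift provides a desuspension \<open>u\<close> of the
  unit; tensoring with it undoes a shift.\<close>

lemma ex_unshift:
  assumes a: "a \<in> Ob K"
  obtains u where "u \<in> Ob K" "isomorphic K (u \<otimes>\<^sub>O ShiftO K a) a"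
proof -
  obtain u where u: "u \<in> Ob K" "isomorphic K (ShiftO K u) (Unit K)"
    using shift_equivalence Unit_Ob unfolding equivalence_functor_def isomorphic_def by blast
  have "isomorphic K (u \<otimes>\<^sub>O ShiftO K a) (ShiftO K (u \<otimes>\<^sub>O a))"
    using isomorphic_ShiftO_TensO_right u a by blast
  moreover have "isomorphic K (ShiftO K (u \<otimes>\<^sub>O a)) (ShiftO K u \<otimes>\<^sub>O a)"
    using isomorphic_ShiftO_TensO_left u a isomorphic_sym by blast
  moreover have "isomorphic K (ShiftO K u \<otimes>\<^sub>O a) (Unit K \<otimes>\<^sub>O a)"
    using isomorphic_TensO u a isomorphic_refl by blast
  moreover have "isomorphic K (Unit K \<otimes>\<^sub>O a) a"
    using isomorphic_LUnit a by blast
  ultimately show thesis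
    using that u(1) isomorphic_trans by meson
qed

section \<open>Closure properties and constructions of tt-ideals\<close>

lemma tt_idealD:
  assumes "tt_ideal K J"
  shows "J \<subseteq> Ob K" "zero_object K z \<Longrightarrow> z \<in> J" "a \<in> J \<Longrightarrow> isomorphic K a b \<Longrightarrow> b \<in> J"
    "a \<in> Ob K \<Longrightarrow> ShiftO K a \<in> J \<longleftrightarrow> a \<in> J"
    "dist_triangle K a b c f g h \<Longrightarrow> a \<in> J \<Longrightarrow> b \<in> J \<Longrightarrow> c \<in> J"
    "dist_triangle K a b c f g h \<Longrightarrow> b \<in> J \<Longrightarrow> c \<in> J \<Longrightarrow> a \<in> J"
    "dist_triangle K a b c f g h \<Longrightarrow> a \<in> J \<Longrightarrow> c \<in> J \<Longrightarrow> b \<in> J"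
    "k \<in> Ob K \<Longrightarrow> a \<in> J \<Longrightarrow> k \<otimes>\<^sub>O a \<in> J"
proof -
  have T: "thick_subcategory K J"
    using assms unfolding tt_ideal_def by blast
  then show 1: "J \<subseteq> Ob K"
    unfolding thick_subcategory_def by blast
  show "zero_object K z \<Longrightarrow> z \<in> J" "a \<in> Ob K \<Longrightarrow> ShiftO K a \<in> J \<longleftrightarrow> a \<in> J"
    using T unfolding thick_subcategory_def by blast+
  show "a \<in> J \<Longrightarrow> isomorphic K a b \<Longrightarrow> b \<in> J"
    using T isomorphic_Ob[of a b] unfolding thick_subcategory_def isomorphic_def by blast
  have "\<forall>a b c f g h. dist_triangle K a b c f g h \<longrightarrow>
        (a \<in> J \<and> b \<in> J \<longrightarrow> c \<in> J) \<and> (b \<in> J \<and> c \<in> J \<longrightarrow> a \<in> J) \<and> (a \<in> J \<and> c \<in> J \<longrightarrow> b \<in> J)"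
    using T unfolding thick_subcategory_def by blast
  then show "dist_triangle K a b c f g h \<Longrightarrow> a \<in> J \<Longrightarrow> b \<in> J \<Longrightarrow> c \<in> J"
    "dist_triangle K a b c f g h \<Longrightarrow> b \<in> J \<Longrightarrow> c \<in> J \<Longrightarrow> a \<in> J"
    "dist_triangle K a b c f g h \<Longrightarrow> a \<in> J \<Longrightarrow> c \<in> J \<Longrightarrow> b \<in> J"
    by blast+
  show "k \<in> Ob K \<Longrightarrow> a \<in> J \<Longrightarrow> k \<otimes>\<^sub>O a \<in> J"
    using assms unfolding tt_ideal_def by blast
qed

lemma tt_ideal_thick: "tt_ideal K J \<Longrightarrow> thick_subcategory K J"
  unfolding tt_ideal_def by blast

lemma tt_ideal_TensO_right:
  assumes "tt_ideal K J" "a \<in> J" "k \<in> Ob K"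
  shows "a \<otimes>\<^sub>O k \<in> J"
  using tt_idealD(1,3,8)[OF assms(1)] assms isomorphic_Braid by blast

lemma tt_ideal_Unit:
  assumes "tt_ideal K J" "Unit K \<in> J"
  shows "J = Ob K"
proof -
  have "k \<in> J" if "k \<in> Ob K" for k
    using tt_idealD(3)[OF assms(1) tt_idealD(8)[OF assms(1) that assms(2)] isomorphic_RUnit[OF that]] .
  then show ?thesis
    using tt_idealD(1)[OF assms(1)] by blast
qed

lemma tt_ideal_Ob: "tt_ideal K (Ob K)"
  unfolding tt_ideal_def thick_subcategory_def
  using zero_object_iff ShiftO_Ob TensO_Ob dist_triangle_Hom Hom_Ob by (smt (verit) subset_refl)

text \<open>Shifts are tensor multiples and conversely, so an ideal needs no separate closure under
  shifts, and two-out-of-three reduces to the middle term of a triangle.\<close>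

lemma tt_idealI:
  assumes Ob: "J \<subseteq> Ob K"
    and zero: "\<And>z. zero_object K z \<Longrightarrow> z \<in> J"
    and iso: "\<And>a b. a \<in> J \<Longrightarrow> isomorphic K a b \<Longrightarrow> b \<in> J"
    and middle: "\<And>a b c f g h. dist_triangle K a b c f g h \<Longrightarrow> a \<in> J \<Longrightarrow> c \<in> J \<Longrightarrow> b \<in> J"
    and summand: "\<And>a b s. is_biproduct K a b s \<Longrightarrow> s \<in> J \<Longrightarrow> a \<in> J \<and> b \<in> J"
    and tensor: "\<And>k a. k \<in> Ob K \<Longrightarrow> a \<in> J \<Longrightarrow> k \<otimes>\<^sub>O a \<in> J"
  shows "tt_ideal K J"
proof -
  have sh: "a \<in> J \<longleftrightarrow> ShiftO K a \<in> J" if a: "a \<in> Ob K" for a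
  proof
    assume "a \<in> J"
    then show "ShiftO K a \<in> J"
      using tensor[OF ShiftO_Ob[OF Unit_Ob]] iso isomorphic_shift_Unit_TensO[OF a] by blast
  next
    assume "ShiftO K a \<in> J"
    moreover obtain u where "u \<in> Ob K" "isomorphic K (u \<otimes>\<^sub>O ShiftO K a) a"
      using ex_unshift[OF a] by blast
    ultimately show "a \<in> J"
      using tensor iso by blast
  qed
  have "(a \<in> J \<and> b \<in> J \<longrightarrow> c \<in> J) \<and> (b \<in> J \<and> c \<in> J \<longrightarrow> a \<in> J) \<and> (a \<in> J \<and> c \<in> J \<longrightarrow> b \<in> J)"
    if t: "dist_triangle K a b c f g h" for a b c f g h
  proof -
    note t1 = dist_triangle_rotate[OF t]
    note t2 = dist_triangle_rotate[OF t1]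
    have O: "a \<in> Ob K" "b \<in> Ob K"
      using dist_triangle_Hom[OF t] Hom_Ob by blast+
    show ?thesis
      using middle[OF t] middle[OF t1] middle[OF t2] sh[OF O(1)] sh[OF O(2)] by blast
  qed
  then show ?thesis
    unfolding tt_ideal_def thick_subcategory_def
    using Ob zero iso sh summand tensor unfolding isomorphic_def by blast
qed

text \<open>The ideal quotient P : x, obtained as the preimage of \<open>P\<close> under the exact
  functor tensoring with \<open>x\<close>.\<close>

lemma tt_ideal_colon:
  assumes P: "tt_ideal K P" and x: "x \<in> Ob K"
  shows "tt_ideal K {m \<in> Ob K. x \<otimes>\<^sub>O m \<in> P}"
proof -
  obtain \<theta> where "exact_functor K K (\<lambda>m. x \<otimes>\<^sub>O m) (\<lambda>f. Id K x \<otimes>\<^sub>A f) \<theta>"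
    using tensor_exact_right x by blast
  then have "thick_subcategory K {m \<in> Ob K. x \<otimes>\<^sub>O m \<in> P}"
    using thick_subcategory_preimage[OF triangulated_category_axioms triangulated_category_axioms]
      tt_ideal_thick[OF P] by blast
  moreover have "x \<otimes>\<^sub>O (k \<otimes>\<^sub>O m) \<in> P" if "k \<in> Ob K" "m \<in> Ob K" "x \<otimes>\<^sub>O m \<in> P" for k m
    using tt_idealD(3)[OF P tt_idealD(8)[OF P]] isomorphic_left_Comm that x by blast
  ultimately show ?thesis
    unfolding tt_ideal_def using TensO_Ob by blast
qed

text \<open>Supplies the tt-ideal generated by an object without describing its members.\<close>

lemma tt_ideal_Inter:
  assumes "M \<noteq> {}" "\<And>Q. Q \<in> M \<Longrightarrow> tt_ideal K Q"
  shows "tt_ideal K (\<Inter>M)"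
proof -
  note D = tt_idealD[OF assms(2)]
  show ?thesis
  proof (rule tt_idealI)
    show "\<Inter>M \<subseteq> Ob K"
      using assms(1) D(1) by blast
    show "z \<in> \<Inter>M" if "zero_object K z" for z
      using D(2) that by blast
    show "b \<in> \<Inter>M" if "a \<in> \<Inter>M" "isomorphic K a b" for a b
      using D(3) that by blast
    show "b \<in> \<Inter>M" if "dist_triangle K a b c f g h" "a \<in> \<Inter>M" "c \<in> \<Inter>M" for a b c f g h
      using D(7)[OF _ that(1)] that(2,3) by blast
    show "k \<otimes>\<^sub>O a \<in> \<Inter>M" if "k \<in> Ob K" "a \<in> \<Inter>M" for k a
      using D(8) that by blast
    show "a \<in> \<Inter>M \<and> b \<in> \<Inter>M" if s: "is_biproduct K a b s" "s \<in> \<Inter>M" for a b s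
    proof -
      have "a \<in> Ob K" "b \<in> Ob K"
        using s(1) Hom_Ob unfolding is_biproduct_def by blast+
      then have "a \<in> Q \<and> b \<in> Q" if "Q \<in> M" for Q
        using tt_ideal_thick[OF assms(2)[OF that]] s that unfolding thick_subcategory_def by blast
      then show ?thesis
        by blast
    qed
  qed
qed

text \<open>Needed for the chains in Zorn's lemma and for the union of the quotients P : s over a
  multiplicative set. Directedness is what handles triangles, whose two outer terms may come from
  different ideals.\<close>

lemma tt_ideal_directed_Union:
  assumes "M \<noteq> {}" "\<And>Q. Q \<in> M \<Longrightarrow> tt_ideal K Q"
    and dir: "\<And>Q R. Q \<in> M \<Longrightarrow> R \<in> M \<Longrightarrow> \<exists>S\<in>M. Q \<subseteq> S \<and> R \<subseteq> S"
  shows "tt_ideal K (\<Union>M)"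
proof -
  note D = tt_idealD[OF assms(2)]
  show ?thesis
  proof (rule tt_idealI)
    show "\<Union>M \<subseteq> Ob K"
      using D(1) by blast
    show "z \<in> \<Union>M" if "zero_object K z" for z
      using D(2) assms(1) that by blast
    show "b \<in> \<Union>M" if "a \<in> \<Union>M" "isomorphic K a b" for a b
      using D(3) that by blast
    show "b \<in> \<Union>M" if t: "dist_triangle K a b c f g h" and ac: "a \<in> \<Union>M" "c \<in> \<Union>M" for a b c f g h
    proof -
      obtain Q R where "Q \<in> M" "R \<in> M" "a \<in> Q" "c \<in> R"
        using ac by blast
      then obtain S where "S \<in> M" "a \<in> S" "c \<in> S"
        using dir by blast
      then show ?thesis
        using D(7)[OF _ t] by blast
    qed
    show "k \<otimes>\<^sub>O a \<in> \<Union>M" if "k \<in> Ob K" "a \<in> \<Union>M" for k a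
      using D(8) that by blast
    show "a \<in> \<Union>M \<and> b \<in> \<Union>M" if s: "is_biproduct K a b s" "s \<in> \<Union>M" for a b s
    proof -
      obtain Q where Q: "Q \<in> M" "s \<in> Q"
        using s by blast
      have "a \<in> Ob K" "b \<in> Ob K"
        using s(1) Hom_Ob unfolding is_biproduct_def by blast+
      then have "a \<in> Q \<and> b \<in> Q"
        using tt_ideal_thick[OF assms(2)[OF Q(1)]] s(1) Q(2) unfolding thick_subcategory_def by blast
      then show ?thesis
        using Q by blast
    qed
  qed
qed

text \<open>Instead of generating ideals, primality of a maximal P avoiding S is checked with the ideals
  P : l and the union of the P : s for s in S.\<close>

lemma ex_prime_tt_ideal:
  assumes J: "tt_ideal K J"
    and S: "S \<subseteq> Ob K" "Unit K \<in> S" "\<And>s t. s \<in> S \<Longrightarrow> t \<in> S \<Longrightarrow> s \<otimes>\<^sub>O t \<in> S" "S \<inter> J = {}"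
  shows "\<exists>P\<in>Spc K. J \<subseteq> P \<and> S \<inter> P = {}"
proof -
  define A where "A = {Q. tt_ideal K Q \<and> J \<subseteq> Q \<and> S \<inter> Q = {}}"
  have "\<exists>P\<in>A. \<forall>Q\<in>A. P \<subseteq> Q \<longrightarrow> Q = P"
  proof (rule subset_Zorn_nonempty)
    show "A \<noteq> {}"
      using J S(4) unfolding A_def by blast
    show "\<Union>M \<in> A" if M: "M \<noteq> {}" "subset.chain A M" for M
    proof -
      have MA: "tt_ideal K Q" "J \<subseteq> Q" "S \<inter> Q = {}" if "Q \<in> M" for Q
        using M(2) that unfolding subset_chain_def A_def by auto
      have chain: "Q \<subseteq> R \<or> R \<subseteq> Q" if "Q \<in> M" "R \<in> M" for Q R
        using M(2) that unfolding subset_chain_def by simp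
      have "tt_ideal K (\<Union>M)"
        using tt_ideal_directed_Union[OF M(1)] MA(1) chain by (meson subset_refl)
      moreover have "J \<subseteq> \<Union>M" "S \<inter> \<Union>M = {}"
        using M(1) MA(2,3) by fast+
      ultimately show ?thesis
        unfolding A_def by simp
    qed
  qed
  then obtain P where PA: "P \<in> A" "\<forall>Q\<in>A. P \<subseteq> Q \<longrightarrow> Q = P"
    by blast
  then have P: "tt_ideal K P" "J \<subseteq> P" "S \<inter> P = {}"
    unfolding A_def by simp_all
  have max: "Q = P" if "tt_ideal K Q" "P \<subseteq> Q" "S \<inter> Q = {}" for Q
  proof -
    have "Q \<in> A"
      using that P(2) unfolding A_def by simp
    then show ?thesis
      using PA(2) that(2) by simp
  qed
  note D = tt_idealD[OF P(1)]
  have "l \<in> P" if k: "k \<in> Ob K" "k \<notin> P" and l: "l \<in> Ob K" and kl: "k \<otimes>\<^sub>O l \<in> P" for k l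
  proof -
    \<comment> \<open>The quotient P : l contains \<open>P\<close> and also \<open>k\<close>, so it
      is strictly larger than \<open>P\<close> and must meet \<open>S\<close> by maximality.\<close>
    let ?Q = "{m \<in> Ob K. l \<otimes>\<^sub>O m \<in> P}"
    have "tt_ideal K ?Q" "P \<subseteq> ?Q"
      using tt_ideal_colon[OF P(1) l] D(1,8) l by blast+
    moreover have "k \<in> ?Q"
      using k l kl D(3) isomorphic_Braid by blast
    ultimately obtain s where s: "s \<in> S" "l \<otimes>\<^sub>O s \<in> P"
      using max[of ?Q] k(2) by blast
    \<comment> \<open>The quotients P : s and P : t both lie in P : (s tensor t), so their union is
      an ideal. It avoids \<open>S\<close>, as s tensor t would otherwise lie in both
      \<open>S\<close> and \<open>P\<close>; by maximality it equals \<open>P\<close>. The object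
      \<open>s\<close> just found puts \<open>l\<close> into it.\<close>
    define M where "M = (\<lambda>s. {m \<in> Ob K. s \<otimes>\<^sub>O m \<in> P}) ` S"
    have mem: "m \<in> \<Union>M \<longleftrightarrow> m \<in> Ob K \<and> (\<exists>s\<in>S. s \<otimes>\<^sub>O m \<in> P)" for m
      unfolding M_def by auto
    have "tt_ideal K (\<Union>M)"
    proof (rule tt_ideal_directed_Union)
      show "M \<noteq> {}"
        unfolding M_def using S(2) by blast
      show "tt_ideal K Q" if "Q \<in> M" for Q
        using that tt_ideal_colon[OF P(1)] S(1) unfolding M_def by blast
      show "\<exists>U\<in>M. Q \<subseteq> U \<and> R \<subseteq> U" if QR: "Q \<in> M" "R \<in> M" for Q R
      proof -
        obtain s t where st: "s \<in> S" "t \<in> S" "Q = {m \<in> Ob K. s \<otimes>\<^sub>O m \<in> P}" "R = {m \<in> Ob K. t \<otimes>\<^sub>O m \<in> P}"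
          using QR unfolding M_def by blast
        have O: "s \<in> Ob K" "t \<in> Ob K"
          using st S(1) by blast+
        have "(s \<otimes>\<^sub>O t) \<otimes>\<^sub>O m \<in> P" if "m \<in> Ob K" "t \<otimes>\<^sub>O m \<in> P" for m
          using D(3)[OF D(8)[OF O(1) that(2)]] isomorphic_sym[OF isomorphic_Assoc[OF O that(1)]] by blast
        moreover have "(s \<otimes>\<^sub>O t) \<otimes>\<^sub>O m \<in> P" if "m \<in> Ob K" "s \<otimes>\<^sub>O m \<in> P" for m
          using D(3)[OF D(8)[OF O(2) that(2)]]
            isomorphic_trans[OF isomorphic_left_Comm[OF O(2,1) that(1)]
              isomorphic_sym[OF isomorphic_Assoc[OF O that(1)]]] by blast
        ultimately have "Q \<subseteq> {m \<in> Ob K. (s \<otimes>\<^sub>O t) \<otimes>\<^sub>O m \<in> P}" "R \<subseteq> {m \<in> Ob K. (s \<otimes>\<^sub>O t) \<otimes>\<^sub>O m \<in> P}"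
          unfolding st(3,4) by auto
        moreover have "{m \<in> Ob K. (s \<otimes>\<^sub>O t) \<otimes>\<^sub>O m \<in> P} \<in> M"
          unfolding M_def using S(3)[OF st(1,2)] by (rule imageI)
        ultimately show ?thesis
          by (intro bexI conjI)
      qed
    qed
    moreover have "P \<subseteq> \<Union>M"
    proof
      fix p assume p: "p \<in> P"
      then have "Unit K \<otimes>\<^sub>O p \<in> P"
        using D(8) Unit_Ob by blast
      then show "p \<in> \<Union>M"
        unfolding mem using p D(1) S(2) by blast
    qed
    moreover have "S \<inter> \<Union>M = {}"
      using mem S(3) P(3) by (meson disjoint_iff)
    ultimately have "\<Union>M = P"
      by (rule max)
    moreover have "l \<in> \<Union>M"
      unfolding mem using s l D(3)[OF s(2) isomorphic_Braid[OF l]] S(1) by blast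
    ultimately show "l \<in> P"
      by simp
  qed
  moreover have "P \<noteq> Ob K"
    using P(3) S(2) Unit_Ob by blast
  ultimately have "prime_tt_ideal K P"
    unfolding prime_tt_ideal_def using P(1) by blast
  then show ?thesis
    unfolding Spc_def using P by blast
qed

lemma SpcD:
  assumes "P \<in> Spc K"
  shows "tt_ideal K P" "Unit K \<notin> P" "k \<in> Ob K \<Longrightarrow> l \<in> Ob K \<Longrightarrow> k \<otimes>\<^sub>O l \<in> P \<longleftrightarrow> k \<in> P \<or> l \<in> P"
proof -
  show I: "tt_ideal K P"
    using assms unfolding Spc_def prime_tt_ideal_def by blast
  then show "Unit K \<notin> P"
    using assms tt_ideal_Unit unfolding Spc_def prime_tt_ideal_def by blast
  show "k \<in> Ob K \<Longrightarrow> l \<in> Ob K \<Longrightarrow> k \<otimes>\<^sub>O l \<in> P \<longleftrightarrow> k \<in> P \<or> l \<in> P"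
    using assms tt_idealD(8)[OF I] tt_ideal_TensO_right[OF I]
    unfolding Spc_def prime_tt_ideal_def by blast
qed

text \<open>The cone of the zero map acts as direct sum. It merges two membership conditions into
  one, dually to the tensor product, which merges two non-membership conditions.\<close>

lemma ex_sum_object:
  assumes "k \<in> Ob K" "l \<in> Ob K"
  obtains z where "z \<in> Ob K" "\<And>P. P \<in> Spc K \<Longrightarrow> z \<in> P \<longleftrightarrow> k \<in> P \<and> l \<in> P"
proof -
  obtain z g h where z: "dist_triangle K k l z (Zero K k l) g h"
    using Tri_cone[OF Zero_Hom[OF assms]] by auto
  then have "z \<in> Ob K"
    using Hom_Ob[OF dist_triangle_Hom(2)[OF z]] by blast
  then show thesis
    by (rule that) (rule thick_zero_cone_iff[OF tt_ideal_thick[OF SpcD(1)] z])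
qed

end

section \<open>Tensor nilpotence\<close>

text \<open>Source and target are read off the arrow, so vanishing can be moved along
  \<open>arrow_iso\<close> without naming either.\<close>

definition null_arrow :: "('o, 'm, 'x) tri_data_scheme \<Rightarrow> 'm \<Rightarrow> bool" where
  "null_arrow C f \<longleftrightarrow> f = Zero C (Dom C f) (Cod C f)"

context additive_category
begin

lemma null_arrow_iff: "f \<in> Hom C a b \<Longrightarrow> null_arrow C f \<longleftrightarrow> f = Zero C a b"
  by (simp add: null_arrow_def Hom_def)

lemma null_arrow_Comp:
  assumes "f \<in> Hom C a b" "g \<in> Hom C b c" "null_arrow C f \<or> null_arrow C g"
  shows "null_arrow C (g \<cdot> f)"
proof -
  have "a \<in> Ob C" "c \<in> Ob C"
    using Hom_Ob[OF assms(1)] Hom_Ob[OF assms(2)] by blast+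
  then show ?thesis
    using assms(3) Comp_Zero_left[OF assms(1)] Comp_Zero_right[OF assms(2)]
    unfolding null_arrow_iff[OF Comp_Hom[OF assms(1,2)]] null_arrow_iff[OF assms(1)]
      null_arrow_iff[OF assms(2)] by blast
qed

lemma null_arrow_iso: "arrow_iso C f g \<Longrightarrow> null_arrow C f \<Longrightarrow> null_arrow C g"
  unfolding null_arrow_def by (rule arrow_iso_Zero)

lemma null_arrow_iso_iff: "arrow_iso C f g \<Longrightarrow> null_arrow C f \<longleftrightarrow> null_arrow C g"
  using null_arrow_iso[of f g] null_arrow_iso[of g f] arrow_iso_sym[of f g] by blast

end

context tt_category
begin

lemma TensA_decompose:
  assumes "f \<in> Hom K a b" "g \<in> Hom K c d"
  shows "f \<otimes>\<^sub>A g = (f \<otimes>\<^sub>A Id K d) \<cdot> (Id K a \<otimes>\<^sub>A g)" "f \<otimes>\<^sub>A g = (Id K b \<otimes>\<^sub>A g) \<cdot> (f \<otimes>\<^sub>A Id K c)"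
proof -
  have O: "a \<in> Ob K" "b \<in> Ob K" "c \<in> Ob K" "d \<in> Ob K"
    using assms Hom_Ob by blast+
  note I = O[THEN Id_Hom]
  show "f \<otimes>\<^sub>A g = (f \<otimes>\<^sub>A Id K d) \<cdot> (Id K a \<otimes>\<^sub>A g)"
    using TensA_Comp[OF I(1) assms I(4)] Id_left[OF assms(2)] Id_right[OF assms(1)] by simp
  show "f \<otimes>\<^sub>A g = (Id K b \<otimes>\<^sub>A g) \<cdot> (f \<otimes>\<^sub>A Id K c)"
    using TensA_Comp[OF assms(1) I(2,3) assms(2)] Id_left[OF assms(1)] Id_right[OF assms(2)] by simp
qed

lemma null_arrow_TensA:
  assumes "f \<in> Hom K a b" "g \<in> Hom K c d" "null_arrow K f \<or> null_arrow K g"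
  shows "null_arrow K (f \<otimes>\<^sub>A g)"
proof -
  have O: "a \<in> Ob K" "b \<in> Ob K" "c \<in> Ob K" "d \<in> Ob K"
    using assms Hom_Ob by blast+
  note I = O[THEN Id_Hom]
  note A = additive_category_axioms
  have 1: "null_arrow K (f \<otimes>\<^sub>A Id K d)" if "null_arrow K f"
    using that additive_functor_Zero[OF A A tensor_left_additive[OF O(4)] O(1,2)] assms(1)
      null_arrow_iff[OF TensA_Hom[OF assms(1) I(4)]] null_arrow_iff[OF assms(1)] by simp
  have 2: "null_arrow K (Id K a \<otimes>\<^sub>A g)" if "null_arrow K g"
    using that additive_functor_Zero[OF A A tensor_right_additive[OF O(1)] O(3,4)] assms(2)
      null_arrow_iff[OF TensA_Hom[OF I(1) assms(2)]] null_arrow_iff[OF assms(2)] by simp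
  show ?thesis
    unfolding TensA_decompose(1)[OF assms(1,2)]
    using null_arrow_Comp[OF TensA_Hom[OF I(1) assms(2)] TensA_Hom[OF assms(1) I(4)]] 1 2 assms(3)
    by blast
qed

text \<open>If one power vanishes then so do all higher ones, being isomorphic to a tensor product
  with that power. Hence "eventually" reduces to existence.\<close>

lemma tensor_nilpotent_iff:
  assumes f: "f \<in> Hom K a b"
  shows "tensor_nilpotent K f \<longleftrightarrow> (\<exists>s. null_arrow K (tensor_power_ar K f s))"
proof -
  note H = tensor_power_ar_Hom[OF f]
  have "null_arrow K (tensor_power_ar K f (s + t))" if "null_arrow K (tensor_power_ar K f s)" for s t
    using null_arrow_iso[OF arrow_iso_tensor_power_add[OF f]] null_arrow_TensA[OF H H] that by blast
  then have "(\<exists>s. null_arrow K (tensor_power_ar K f s)) \<longleftrightarrow>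
      (\<forall>\<^sub>F s in sequentially. null_arrow K (tensor_power_ar K f s))"
    unfolding eventually_sequentially by (metis le_Suc_ex le_refl)
  moreover have "Dom K f = a" "Cod K f = b"
    using f by (auto simp: Hom_def)
  ultimately show ?thesis
    unfolding tensor_nilpotent_def using null_arrow_iff[OF H] by simp
qed

lemma tensor_nilpotent_on_iff:
  assumes f: "f \<in> Hom K a b" and m: "m \<in> Ob K"
  shows "tensor_nilpotent_on K f m \<longleftrightarrow> (\<exists>s. null_arrow K (tensor_power_ar K f s \<otimes>\<^sub>A Id K m))"
proof -
  note H = tensor_power_ar_Hom[OF f]
  note I = Id_Hom[OF m]
  have "null_arrow K (tensor_power_ar K f (s + t) \<otimes>\<^sub>A Id K m)"
    if "null_arrow K (tensor_power_ar K f s \<otimes>\<^sub>A Id K m)" for s t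
  proof -
    have "null_arrow K (tensor_power_ar K f t \<otimes>\<^sub>A (tensor_power_ar K f s \<otimes>\<^sub>A Id K m))"
      using null_arrow_TensA[OF H TensA_Hom[OF H I]] that by blast
    then have "null_arrow K ((tensor_power_ar K f t \<otimes>\<^sub>A tensor_power_ar K f s) \<otimes>\<^sub>A Id K m)"
      using null_arrow_iso_iff[OF arrow_iso_Assoc[OF H H I]] by blast
    then show ?thesis
      using null_arrow_iso_iff[OF arrow_iso_TensA[OF arrow_iso_tensor_power_add[OF f] arrow_iso_refl[OF I]]]
      by (metis add.commute)
  qed
  then have "(\<exists>s. null_arrow K (tensor_power_ar K f s \<otimes>\<^sub>A Id K m)) \<longleftrightarrow>
      (\<forall>\<^sub>F s in sequentially. null_arrow K (tensor_power_ar K f s \<otimes>\<^sub>A Id K m))"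
    unfolding eventually_sequentially by (metis le_Suc_ex le_refl)
  moreover have "Dom K f = a" "Cod K f = b"
    using f by (auto simp: Hom_def)
  ultimately show ?thesis
    unfolding tensor_nilpotent_on_def using null_arrow_iff[OF TensA_Hom[OF H I]] by simp
qed

text \<open>The ideal N(f) of the overview; the exponent may depend on \<open>m\<close>, and one
  vanishing exponent suffices by \<open>tensor_nilpotent_on_iff\<close>.\<close>

definition nilpotence_ideal :: "'m \<Rightarrow> 'o set" where
  "nilpotence_ideal f = {m \<in> Ob K. \<exists>s. null_arrow K (tensor_power_ar K f s \<otimes>\<^sub>A Id K m)}"

text \<open>On the retract, \<open>x\<close> tensor \<open>Id K a\<close> factors through
  \<open>x\<close> tensor \<open>Id K s\<close> by inserting \<open>i\<close> before and
  \<open>p\<close> after.\<close>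

lemma null_arrow_retract:
  assumes x: "x \<in> Hom K c d" and p: "p \<in> Hom K s a" and i: "i \<in> Hom K a s" and "p \<cdot> i = Id K a"
    and s: "null_arrow K (x \<otimes>\<^sub>A Id K s)"
  shows "null_arrow K (x \<otimes>\<^sub>A Id K a)"
proof -
  have O: "s \<in> Ob K" "c \<in> Ob K" "d \<in> Ob K"
    using assms Hom_Ob by blast+
  note I = O[THEN Id_Hom]
  have "(x \<otimes>\<^sub>A Id K s) \<cdot> (Id K c \<otimes>\<^sub>A i) = x \<otimes>\<^sub>A i"
    using TensA_decompose(1)[OF x i] by simp
  moreover have "(Id K d \<otimes>\<^sub>A p) \<cdot> (x \<otimes>\<^sub>A i) = x \<otimes>\<^sub>A Id K a"
    using TensA_Comp[OF x I(3) i p] Id_left[OF x] assms(4) by simp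
  moreover have "null_arrow K ((x \<otimes>\<^sub>A Id K s) \<cdot> (Id K c \<otimes>\<^sub>A i))"
    using null_arrow_Comp[OF TensA_Hom[OF I(2) i] TensA_Hom[OF x I(1)]] s by blast
  ultimately show ?thesis
    using null_arrow_Comp[OF TensA_Hom[OF x i] TensA_Hom[OF I(3) p]] by simp
qed

text \<open>The substantial point is closure under extensions: exponents \<open>s\<close> and
  \<open>r\<close> for the outer terms of a triangle add up to \<open>r + s\<close> for the middle
  one.\<close>

lemma tt_ideal_nilpotence_ideal:
  assumes f: "f \<in> Hom K a b"
  shows "tt_ideal K (nilpotence_ideal f)"
proof -
  let ?N = "nilpotence_ideal f" and ?f = "tensor_power_ar K f"
  note H = tensor_power_ar_Hom[OF f]
  have PO: "tensor_power_ob K a s \<in> Ob K" "tensor_power_ob K b s \<in> Ob K" for s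
    using f Hom_Ob tensor_power_ob_Ob by blast+
  \<comment> \<open>Closure under retracts covers isomorphic objects and direct summands at
    once.\<close>
  have ret: "c \<in> ?N" if "m \<in> ?N" "p \<in> Hom K m c" "i \<in> Hom K c m" "p \<cdot> i = Id K c" for c m p i
    using that null_arrow_retract[OF H that(2-4)] Hom_Ob unfolding nilpotence_ideal_def by blast
  show ?thesis
  proof (rule tt_idealI)
    show "?N \<subseteq> Ob K"
      unfolding nilpotence_ideal_def by blast
    show "z \<in> ?N" if "zero_object K z" for z
    proof -
      have z: "z \<in> Ob K" "null_arrow K (Id K z)"
        using that zero_object_iff[of z] null_arrow_iff[OF Id_Hom[of z]] by blast+
      then show ?thesis
        unfolding nilpotence_ideal_def using null_arrow_TensA[OF H Id_Hom[OF z(1)]] by blast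
    qed
    show "d \<in> ?N" if c: "c \<in> ?N" and cd: "isomorphic K c d" for c d
    proof -
      obtain u where "u \<in> isos K c d"
        using cd unfolding isomorphic_def by blast
      then obtain v where "u \<in> Hom K c d" "v \<in> Hom K d c" "u \<cdot> v = Id K d"
        by (rule isosE)
      then show ?thesis
        using ret c by blast
    qed
    show "c \<in> ?N \<and> d \<in> ?N" if "is_biproduct K c d s" "s \<in> ?N" for c d s
      using that ret unfolding is_biproduct_def by blast
    show "k \<otimes>\<^sub>O m \<in> ?N" if k: "k \<in> Ob K" and m': "m \<in> ?N" for k m
    proof -
      obtain s where m: "m \<in> Ob K" and s: "null_arrow K (?f s \<otimes>\<^sub>A Id K m)"
        using m' unfolding nilpotence_ideal_def by blast
      note I = Id_Hom[OF k] Id_Hom[OF m]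
      have "null_arrow K ((?f s \<otimes>\<^sub>A Id K m) \<otimes>\<^sub>A Id K k)"
        using null_arrow_TensA[OF TensA_Hom[OF H I(2)] I(1)] s by blast
      moreover have "arrow_iso K ((?f s \<otimes>\<^sub>A Id K m) \<otimes>\<^sub>A Id K k) (?f s \<otimes>\<^sub>A (Id K k \<otimes>\<^sub>A Id K m))"
        using arrow_iso_trans[OF arrow_iso_Assoc[OF H I(2,1)]
            arrow_iso_TensA[OF arrow_iso_refl[OF H] arrow_iso_Braid[OF I(2,1)]]] .
      ultimately show ?thesis
        unfolding nilpotence_ideal_def
        using null_arrow_iso k m TensA_Id[OF k m] TensO_Ob[OF k m] by auto
    qed
    show "d \<in> ?N" if t: "dist_triangle K c d e u v w" and ce: "c \<in> ?N" "e \<in> ?N" for c d e u v w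
    proof -
      obtain s where s: "null_arrow K (?f s \<otimes>\<^sub>A Id K c)"
        using ce unfolding nilpotence_ideal_def by blast
      obtain r where r: "null_arrow K (?f r \<otimes>\<^sub>A Id K e)"
        using ce unfolding nilpotence_ideal_def by blast
      note uvw = dist_triangle_Hom[OF t]
      have O: "c \<in> Ob K" "d \<in> Ob K" "e \<in> Ob K"
        using Hom_Ob uvw by blast+
      note I = O[THEN Id_Hom]
      let ?X = "tensor_power_ob K a s" and ?Y = "tensor_power_ob K b s"
      let ?X' = "tensor_power_ob K a r" and ?Y' = "tensor_power_ob K b r"
      note IX = Id_Hom[OF PO(1)[of s]] and IY = Id_Hom[OF PO(2)[of s]]
        and IX' = Id_Hom[OF PO(1)[of r]] and IY' = Id_Hom[OF PO(2)[of r]]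
      obtain w' where t': "dist_triangle K (?X \<otimes>\<^sub>O c) (?X \<otimes>\<^sub>O d) (?X \<otimes>\<^sub>O e)
          (Id K ?X \<otimes>\<^sub>A u) (Id K ?X \<otimes>\<^sub>A v) w'"
        using tensor_exact_right[OF PO(1)[of s]] t unfolding exact_functor_def by blast
      \<comment> \<open>By interchange, \<open>?f s\<close> tensor \<open>d\<close> restricted along
        \<open>u\<close> passes through \<open>?f s\<close> tensor \<open>c\<close>, which is zero;
        so \<open>?f s\<close> tensor \<open>d\<close> factors through \<open>v\<close> as
        \<open>j\<close>.\<close>
      have "null_arrow K ((Id K ?Y \<otimes>\<^sub>A u) \<cdot> (?f s \<otimes>\<^sub>A Id K c))"
        using null_arrow_Comp[OF TensA_Hom[OF H I(1)] TensA_Hom[OF IY uvw(1)]] s by blast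
      then have "null_arrow K ((?f s \<otimes>\<^sub>A Id K d) \<cdot> (Id K ?X \<otimes>\<^sub>A u))"
        using TensA_decompose[OF H uvw(1)] by metis
      then have "(?f s \<otimes>\<^sub>A Id K d) \<cdot> (Id K ?X \<otimes>\<^sub>A u) = Zero K (?X \<otimes>\<^sub>O c) (?Y \<otimes>\<^sub>O d)"
        using null_arrow_iff[OF Comp_Hom[OF TensA_Hom[OF IX uvw(1)] TensA_Hom[OF H I(2)]]] by blast
      then obtain j where j: "j \<in> Hom K (?X \<otimes>\<^sub>O e) (?Y \<otimes>\<^sub>O d)" "j \<cdot> (Id K ?X \<otimes>\<^sub>A v) = ?f s \<otimes>\<^sub>A Id K d"
        using weak_cokernel[OF t' TensA_Hom[OF H I(2)]] by blast
      note Xv = TensA_Hom[OF IX uvw(2)]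
      \<comment> \<open>After tensoring with \<open>?f r\<close> the factor involving
        \<open>v\<close> passes through \<open>?f r\<close> tensor (\<open>?X\<close> tensor
        \<open>e\<close>), which vanishes up to a braiding because \<open>?f r\<close> kills
        \<open>e\<close>.\<close>
      have "?f r \<otimes>\<^sub>A (?f s \<otimes>\<^sub>A Id K d) = (Id K ?Y' \<otimes>\<^sub>A j) \<cdot> (?f r \<otimes>\<^sub>A (Id K ?X \<otimes>\<^sub>A v))"
        using TensA_Comp[OF H IY' Xv j(1)] j(2) Id_left[OF H] by simp
      moreover have "null_arrow K (?f r \<otimes>\<^sub>A (Id K ?X \<otimes>\<^sub>A v))"
      proof -
        have "arrow_iso K ((?f r \<otimes>\<^sub>A Id K e) \<otimes>\<^sub>A Id K ?X) (?f r \<otimes>\<^sub>A (Id K ?X \<otimes>\<^sub>A Id K e))"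
          using arrow_iso_trans[OF arrow_iso_Assoc[OF H I(3) IX]
              arrow_iso_TensA[OF arrow_iso_refl[OF H] arrow_iso_Braid[OF I(3) IX]]] .
        then have "null_arrow K (?f r \<otimes>\<^sub>A Id K (?X \<otimes>\<^sub>O e))"
          using null_arrow_iso null_arrow_TensA[OF TensA_Hom[OF H I(3)] IX] r TensA_Id[OF PO(1) O(3)]
          by fastforce
        then show ?thesis
          using TensA_decompose(1)[OF H Xv, of r]
            null_arrow_Comp[OF TensA_Hom[OF IX' Xv] TensA_Hom[OF H Id_Hom[OF TensO_Ob[OF PO(1) O(3)]]]]
          by metis
      qed
      ultimately have "null_arrow K (?f r \<otimes>\<^sub>A (?f s \<otimes>\<^sub>A Id K d))"
        using null_arrow_Comp[OF TensA_Hom[OF H Xv] TensA_Hom[OF IY' j(1)]] by simp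
      moreover have "arrow_iso K (?f r \<otimes>\<^sub>A (?f s \<otimes>\<^sub>A Id K d)) (?f (r + s) \<otimes>\<^sub>A Id K d)"
        using arrow_iso_trans[OF arrow_iso_sym[OF arrow_iso_Assoc[OF H H I(2)]]
            arrow_iso_TensA[OF arrow_iso_tensor_power_add[OF f] arrow_iso_refl[OF I(2)]]] .
      ultimately show ?thesis
        unfolding nilpotence_ideal_def using null_arrow_iso O by blast
    qed
  qed
qed

lemma not_tensor_nilpotent_ex_prime:
  assumes f: "f \<in> Hom K a b" and n: "\<not> tensor_nilpotent K f"
  shows "\<exists>P\<in>Spc K. nilpotence_ideal f \<subseteq> P \<and> a \<notin> P"
proof -
  \<comment> \<open>Closed up under isomorphism, since a product of two powers of \<open>a\<close>
    is only isomorphic to a power of \<open>a\<close>.\<close>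
  let ?S = "{x. \<exists>n. isomorphic K x (tensor_power_ob K a n)}"
  note H = tensor_power_ar_Hom[OF f]
  have a: "a \<in> Ob K" "b \<in> Ob K"
    using Hom_Ob[OF f] by blast+
  note O = tensor_power_ob_Ob[OF a(1)] tensor_power_ob_Ob[OF a(2)]
  have "tensor_power_ob K a n \<notin> nilpotence_ideal f" for n
  proof
    assume "tensor_power_ob K a n \<in> nilpotence_ideal f"
    then obtain s where "null_arrow K (tensor_power_ar K f s \<otimes>\<^sub>A Id K (tensor_power_ob K a n))"
      unfolding nilpotence_ideal_def by blast
    \<comment> \<open>Following \<open>?\<close>-power \<open>s\<close> on the object a^n by the
      n-th power of \<open>f\<close> gives f^s tensor f^n, so f^(s+n) would vanish.\<close>
    then have "null_arrow K (tensor_power_ar K f s \<otimes>\<^sub>A tensor_power_ar K f n)"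
      unfolding TensA_decompose(2)[OF H H]
      by (intro null_arrow_Comp[OF TensA_Hom[OF H Id_Hom[OF O(1)]] TensA_Hom[OF Id_Hom[OF O(2)] H]] disjI1)
    then have "null_arrow K (tensor_power_ar K f (s + n))"
      by (rule null_arrow_iso[OF arrow_iso_tensor_power_add[OF f]])
    then show False
      using n tensor_nilpotent_iff[OF f] by blast
  qed
  then have disj: "?S \<inter> nilpotence_ideal f = {}"
    using tt_idealD(3)[OF tt_ideal_nilpotence_ideal[OF f]] by fast
  have "\<exists>P\<in>Spc K. nilpotence_ideal f \<subseteq> P \<and> ?S \<inter> P = {}"
  proof (rule ex_prime_tt_ideal[OF tt_ideal_nilpotence_ideal[OF f]])
    show "?S \<subseteq> Ob K"
      using isomorphic_Ob by blast
    have "isomorphic K (Unit K) (tensor_power_ob K a 0)"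
      using isomorphic_refl[OF Unit_Ob] by simp
    then show "Unit K \<in> ?S"
      by blast
    show "x \<otimes>\<^sub>O y \<in> ?S" if xy: "x \<in> ?S" "y \<in> ?S" for x y
    proof -
      obtain m n where "isomorphic K x (tensor_power_ob K a m)" "isomorphic K y (tensor_power_ob K a n)"
        using xy by blast
      then have "isomorphic K (x \<otimes>\<^sub>O y) (tensor_power_ob K a (m + n))"
        by (rule isomorphic_trans[OF isomorphic_TensO isomorphic_tensor_power_add[OF a(1)]])
      then show ?thesis
        by blast
    qed
  qed (rule disj)
  then obtain P where P: "P \<in> Spc K" "nilpotence_ideal f \<subseteq> P" "?S \<inter> P = {}"
    by auto
  have "isomorphic K a (tensor_power_ob K a 1)"
    using isomorphic_sym[OF isomorphic_LUnit[OF a(1)]] by simp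
  then have "a \<notin> P"
    using P(3) by blast
  then show ?thesis
    using P(1,2) by blast
qed

text \<open>Expresses that \<open>f\<close> becomes invertible in the Verdier quotient by
  \<open>P\<close>, without constructing the quotient.\<close>

definition cone_in :: "'o set \<Rightarrow> 'm \<Rightarrow> bool" where
  "cone_in P f \<longleftrightarrow> (\<exists>a b c g h. dist_triangle K a b c f g h \<and> c \<in> P)"

lemma cone_in_iff:
  assumes "f \<in> Hom K a b"
  shows "cone_in P f \<longleftrightarrow> (\<exists>c g h. dist_triangle K a b c f g h \<and> c \<in> P)"
proof -
  have "a' = a \<and> b' = b" if "dist_triangle K a' b' c f g h" for a' b' c g h
    using dist_triangle_Hom(1)[OF that] assms by (auto simp: Hom_def)
  then show ?thesis
    unfolding cone_in_def by metis
qed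

text \<open>By the octahedral axiom the cone of the composite is an extension of the two given
  cones.\<close>

lemma cone_in_Comp:
  assumes P: "tt_ideal K P" and f: "cone_in P f" "f \<in> Hom K a b" and g: "cone_in P g" "g \<in> Hom K b c"
  shows "cone_in P (g \<cdot> f)"
proof -
  obtain x f1 f2 where x: "dist_triangle K a b x f f1 f2" "x \<in> P"
    using f(1) unfolding cone_in_iff[OF f(2)] by auto
  obtain y g1 g2 where y: "dist_triangle K b c y g g1 g2" "y \<in> P"
    using g(1) unfolding cone_in_iff[OF g(2)] by auto
  obtain z h1 h2 where z: "dist_triangle K a c z (g \<cdot> f) h1 h2"
    using Tri_cone[OF Comp_Hom[OF f(2) g(2)]] by auto
  obtain u v where "dist_triangle K x z y u v (ShiftA K f1 \<cdot> g2)"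
    using Tri_octahedral[OF x(1) y(1) z] by auto
  then have "z \<in> P"
    using tt_idealD(7)[OF P] x(2) y(2) by auto
  then show ?thesis
    unfolding cone_in_iff[OF Comp_Hom[OF f(2) g(2)]] using z by blast
qed

lemma cone_in_TensA:
  assumes P: "tt_ideal K P" and f: "cone_in P f" and k: "k \<in> Ob K"
  shows "cone_in P (f \<otimes>\<^sub>A Id K k)" "cone_in P (Id K k \<otimes>\<^sub>A f)"
proof -
  obtain a b c g h where t: "dist_triangle K a b c f g h" "c \<in> P"
    using f unfolding cone_in_def by blast
  show "cone_in P (f \<otimes>\<^sub>A Id K k)"
    using tensor_exact_left[OF k] t tt_ideal_TensO_right[OF P t(2) k]
    unfolding exact_functor_def cone_in_def by blast
  show "cone_in P (Id K k \<otimes>\<^sub>A f)"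
    using tensor_exact_right[OF k] t tt_idealD(8)[OF P k t(2)]
    unfolding exact_functor_def cone_in_def by blast
qed

text \<open>Each further factor is a composite of two arrows obtained from \<open>f\<close> and from
  the previous power by tensoring with an object. The induction starts at an identity, whose cone is
  zero.\<close>

lemma cone_in_tensor_power:
  assumes P: "tt_ideal K P" and f: "cone_in P f" "f \<in> Hom K a b"
  shows "cone_in P (tensor_power_ar K f s)"
proof (induction s)
  case 0
  obtain z where "zero_object K z"
    using ex_zero_object by blast
  then show ?case
    using Tri_id[OF Unit_Ob] tt_idealD(2)[OF P] unfolding cone_in_def by fastforce
next
  case (Suc s)
  note H = tensor_power_ar_Hom[OF f(2)]
  have O: "tensor_power_ob K a s \<in> Ob K" "b \<in> Ob K"
    using Hom_Ob[OF H] Hom_Ob[OF f(2)] by blast+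
  show ?case
    using cone_in_Comp[OF P cone_in_TensA(2)[OF P f(1) O(1)] TensA_Hom[OF Id_Hom[OF O(1)] f(2)]
        cone_in_TensA(1)[OF P Suc O(2)] TensA_Hom[OF H Id_Hom[OF O(2)]]]
      TensA_decompose(1)[OF H f(2)] by simp
qed

lemma tensor_power_ob_mem_prime:
  assumes P: "P \<in> Spc K" and a: "a \<in> Ob K"
  shows "tensor_power_ob K a s \<in> P \<Longrightarrow> a \<in> P"
  by (induction s) (use SpcD(2,3)[OF P] a tensor_power_ob_Ob in auto)

text \<open>Modulo P, the arrow f is invertible with vanishing tensor power.\<close>

lemma tensor_nilpotent_cone_in_prime:
  assumes P: "P \<in> Spc K" and f: "f \<in> Hom K a b" "tensor_nilpotent K f" "cone_in P f"
  shows "a \<in> P"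
proof -
  note H = tensor_power_ar_Hom[OF f(1)]
  note I = SpcD(1)[OF P]
  obtain s where s: "null_arrow K (tensor_power_ar K f s)"
    using f tensor_nilpotent_iff by blast
  obtain z g h where z: "dist_triangle K (tensor_power_ob K a s) (tensor_power_ob K b s) z
      (tensor_power_ar K f s) g h" "z \<in> P"
    using cone_in_tensor_power[OF I f(3,1), of s] unfolding cone_in_iff[OF H] by blast
  \<comment> \<open>The power is zero, so its cone \<open>z\<close> splits into the target and the
    shifted source; as \<open>z\<close> lies in \<open>P\<close>, so does the source.\<close>
  have "tensor_power_ob K a s \<in> P"
    using thick_zero_cone_iff[OF tt_ideal_thick[OF I] z(1)[unfolded s[unfolded null_arrow_iff[OF H]]]] z(2)
    by blast
  then show ?thesis
    using tensor_power_ob_mem_prime[OF P] Hom_Ob[OF f(1)] by blast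
qed

end

section \<open>The patch topology of the spectrum\<close>

context tt_category
begin

lemma Spc_zero_object: "P \<in> Spc K \<Longrightarrow> zero_object K z \<Longrightarrow> z \<in> P"
  using tt_idealD(2)[OF SpcD(1)] .

text \<open>The tensor product over \<open>E\<close>, which collapses a finite union of basic opens
  to a single one. The empty product is the unit, which lies in no prime.\<close>

lemma ex_tensor_object:
  assumes "finite E" "E \<subseteq> Ob K"
  shows "\<exists>t\<in>Ob K. \<forall>P\<in>Spc K. t \<in> P \<longleftrightarrow> (\<exists>l\<in>E. l \<in> P)"
  using assms
proof (induction E)
  case empty
  show ?case
    using Unit_Ob SpcD(2) by auto
next
  case (insert x E)
  then obtain t where t: "t \<in> Ob K" "\<forall>P\<in>Spc K. t \<in> P \<longleftrightarrow> (\<exists>l\<in>E. l \<in> P)"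
    by auto
  have x: "x \<in> Ob K"
    using insert by simp
  have "\<forall>P\<in>Spc K. x \<otimes>\<^sub>O t \<in> P \<longleftrightarrow> (\<exists>l\<in>insert x E. l \<in> P)"
    using t(2) SpcD(3)[OF _ x t(1)] by simp
  then show ?case
    using TensO_Ob[OF x t(1)] by blast
qed

lemma topspace_Spc_topology: "topspace (Spc_topology K) = Spc K"
proof -
  obtain z where "zero_object K z"
    using ex_zero_object by blast
  then have "z \<in> Ob K" "Spc K - supp K z = Spc K"
    using zero_object_iff Spc_zero_object unfolding supp_def by auto
  then show ?thesis
    unfolding Spc_topology_def topology_generated_by_topspace by auto
qed

lemma openin_Spc_basic: "l \<in> Ob K \<Longrightarrow> openin (Spc_topology K) {P \<in> Spc K. l \<in> P}"
  unfolding Spc_topology_def by (rule topology_generated_by_Basis) (auto simp: supp_def)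

text \<open>The generating sets form a basis: those of \<open>k\<close> and \<open>l\<close>
  intersect in the one of their direct sum.\<close>

lemma openin_Spc_topologyD:
  assumes "openin (Spc_topology K) U" "P \<in> U"
  shows "\<exists>l\<in>Ob K. l \<in> P \<and> {Q \<in> Spc K. l \<in> Q} \<subseteq> U"
proof -
  have P: "P \<in> Spc K"
    using openin_subset[OF assms(1)] assms(2) topspace_Spc_topology by blast
  have "generate_topology_on {Spc K - supp K k |k. k \<in> Ob K} U"
    using assms(1) unfolding Spc_topology_def openin_topology_generated_by_iff .
  then show ?thesis
    using assms(2)
  proof induction
    case (Int U V)
    then obtain k l where kl: "k \<in> Ob K" "k \<in> P" "{Q \<in> Spc K. k \<in> Q} \<subseteq> U"
      "l \<in> Ob K" "l \<in> P" "{Q \<in> Spc K. l \<in> Q} \<subseteq> V"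
      by blast
    obtain z where "z \<in> Ob K" "\<And>P. P \<in> Spc K \<Longrightarrow> z \<in> P \<longleftrightarrow> k \<in> P \<and> l \<in> P"
      using ex_sum_object[OF kl(1,4)] by blast
    then show ?case
      using kl P by (intro bexI[of _ z]) auto
  next
    case (UN \<U>)
    then show ?case
      by (meson Sup_upper UnionE subset_trans)
  next
    case (Basis B)
    then show ?case
      unfolding supp_def by fast
  qed simp
qed

text \<open>The objects whose basic open has a finite subcover form a multiplicative set
  \<open>S\<close>. If \<open>S\<close> missed the ideal generated by \<open>k\<close>, some prime
  would contain \<open>k\<close> and avoid \<open>S\<close>, although the cover gives it a member
  lying in \<open>S\<close>.\<close>

lemma compactin_Spc_basic:
  assumes k: "k \<in> Ob K"
  shows "compactin (Spc_topology K) {P \<in> Spc K. k \<in> P}"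
  unfolding compactin_def topspace_Spc_topology
proof (intro conjI allI impI)
  fix \<U> assume U: "(\<forall>U\<in>\<U>. openin (Spc_topology K) U) \<and> {P \<in> Spc K. k \<in> P} \<subseteq> \<Union>\<U>"
  \<comment> \<open>The cover is refined by basic opens, each contained in one of its
    members.\<close>
  define G where "G = {l \<in> Ob K. \<exists>U\<in>\<U>. {Q \<in> Spc K. l \<in> Q} \<subseteq> U}"
  \<comment> \<open>Objects \<open>t\<close> such that finitely many basic opens indexed by
    \<open>G\<close> cover the primes containing \<open>t\<close>.\<close>
  define S where "S = {t \<in> Ob K. \<exists>E\<subseteq>G. finite E \<and> (\<forall>P\<in>Spc K. t \<in> P \<longrightarrow> E \<inter> P \<noteq> {})}"
  have SI: "t \<in> S" if "t \<in> Ob K" "E \<subseteq> G" "finite E" "\<And>P. P \<in> Spc K \<Longrightarrow> t \<in> P \<Longrightarrow> E \<inter> P \<noteq> {}" for t E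
    unfolding S_def using that by blast
  define J where "J = \<Inter>{Q. tt_ideal K Q \<and> k \<in> Q}"
  have J: "tt_ideal K J"
    unfolding J_def using tt_ideal_Ob k by (intro tt_ideal_Inter) auto
  have "S \<inter> J \<noteq> {}"
  proof
    assume disj: "S \<inter> J = {}"
    have "\<exists>P\<in>Spc K. J \<subseteq> P \<and> S \<inter> P = {}"
    proof (rule ex_prime_tt_ideal[OF J _ _ _ disj])
      show "S \<subseteq> Ob K"
        unfolding S_def by blast
      \<comment> \<open>No prime contains the unit, so the empty family covers.\<close>
      show "Unit K \<in> S"
        by (rule SI[OF Unit_Ob, of "{}"]) (use SpcD(2) in auto)
      show "s \<otimes>\<^sub>O t \<in> S" if st: "s \<in> S" "t \<in> S" for s t
      proof -
        obtain E1 where E1: "E1 \<subseteq> G" "finite E1" "\<forall>P\<in>Spc K. s \<in> P \<longrightarrow> E1 \<inter> P \<noteq> {}"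
          using st(1) unfolding S_def by blast
        obtain E2 where E2: "E2 \<subseteq> G" "finite E2" "\<forall>P\<in>Spc K. t \<in> P \<longrightarrow> E2 \<inter> P \<noteq> {}"
          using st(2) unfolding S_def by blast
        have O: "s \<in> Ob K" "t \<in> Ob K"
          using st unfolding S_def by blast+
        show ?thesis
        proof (rule SI[OF TensO_Ob[OF O], of "E1 \<union> E2"])
          show "(E1 \<union> E2) \<inter> P \<noteq> {}" if "P \<in> Spc K" "s \<otimes>\<^sub>O t \<in> P" for P
            using E1(3) E2(3) SpcD(3)[OF that(1) O] that by auto
        qed (use E1 E2 in auto)
      qed
    qed
    then obtain P where P: "P \<in> Spc K" "J \<subseteq> P" "S \<inter> P = {}"
      by auto
    have "k \<in> P"
      using P(2) unfolding J_def by auto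
    then have "P \<in> \<Union>\<U>"
      using U P(1) by auto
    then obtain V where V: "V \<in> \<U>" "P \<in> V" "openin (Spc_topology K) V"
      using U by auto
    obtain l where l: "l \<in> Ob K" "l \<in> P" "{Q \<in> Spc K. l \<in> Q} \<subseteq> V"
      using openin_Spc_topologyD[OF V(3,2)] by auto
    have "l \<in> G"
      unfolding G_def using l(1,3) V(1) by auto
    then have "l \<in> S"
      by (intro SI[OF l(1), of "{l}"]) auto
    then show False
      using l(2) P(3) by blast
  qed
  then obtain t where t: "t \<in> S" "t \<in> J"
    by auto
  then obtain E where E: "E \<subseteq> G" "finite E" "\<forall>P\<in>Spc K. t \<in> P \<longrightarrow> E \<inter> P \<noteq> {}"
    unfolding S_def by blast
  have "\<forall>l\<in>E. \<exists>U\<in>\<U>. {Q \<in> Spc K. l \<in> Q} \<subseteq> U"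
    using E(1) unfolding G_def by blast
  then obtain u where u: "\<And>l. l \<in> E \<Longrightarrow> u l \<in> \<U> \<and> {Q \<in> Spc K. l \<in> Q} \<subseteq> u l"
    by metis
  have "{P \<in> Spc K. k \<in> P} \<subseteq> \<Union>(u ` E)"
  proof
    fix P assume "P \<in> {P \<in> Spc K. k \<in> P}"
    then have P: "P \<in> Spc K" "k \<in> P"
      by auto
    \<comment> \<open>The ideal \<open>J\<close> lies in every prime containing \<open>k\<close>, so
      a finite cover for \<open>t\<close> also covers for \<open>k\<close>.\<close>
    have "t \<in> P"
      using t(2) SpcD(1)[OF P(1)] P(2) unfolding J_def by simp
    then obtain l where "l \<in> E" "l \<in> P"
      using E(3) P(1) by blast
    then show "P \<in> \<Union>(u ` E)"
      using u P(1) by blast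
  qed
  moreover have "finite (u ` E)" "u ` E \<subseteq> \<U>"
    using E(2) u by auto
  ultimately show "\<exists>\<F>. finite \<F> \<and> \<F> \<subseteq> \<U> \<and> {P \<in> Spc K. k \<in> P} \<subseteq> \<Union>\<F>"
    by blast
qed auto

text \<open>A compact open is a finite union of basic opens, and a tensor product turns this union
  into one basic open.\<close>

lemma compact_open_Spc_iff:
  "openin (Spc_topology K) U \<and> compactin (Spc_topology K) U \<longleftrightarrow> (\<exists>k\<in>Ob K. U = {P \<in> Spc K. k \<in> P})"
proof
  assume U: "openin (Spc_topology K) U \<and> compactin (Spc_topology K) U"
  define G where "G = {l \<in> Ob K. {Q \<in> Spc K. l \<in> Q} \<subseteq> U}"
  let ?B = "\<lambda>l. {Q \<in> Spc K. l \<in> Q}"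
  have "U \<subseteq> \<Union>(?B ` G)"
  proof
    fix P assume P: "P \<in> U"
    then have "P \<in> Spc K"
      using openin_subset U topspace_Spc_topology by blast
    moreover obtain l where "l \<in> Ob K" "l \<in> P" "{Q \<in> Spc K. l \<in> Q} \<subseteq> U"
      using openin_Spc_topologyD U P by blast
    ultimately show "P \<in> \<Union>(?B ` G)"
      unfolding G_def by blast
  qed
  moreover have "\<forall>V\<in>?B ` G. openin (Spc_topology K) V"
    using openin_Spc_basic unfolding G_def by blast
  ultimately obtain \<F> where F: "finite \<F>" "\<F> \<subseteq> ?B ` G" "U \<subseteq> \<Union>\<F>"
    using U unfolding compactin_def by meson
  then obtain E where E: "E \<subseteq> G" "finite E" "\<F> = ?B ` E"
    using finite_subset_image by meson
  obtain t where t: "t \<in> Ob K" "\<forall>P\<in>Spc K. t \<in> P \<longleftrightarrow> (\<exists>l\<in>E. l \<in> P)"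
    using ex_tensor_object[OF E(2)] E(1) unfolding G_def by blast
  have "U = {P \<in> Spc K. t \<in> P}"
    using t(2) E F(3) unfolding G_def by fast
  then show "\<exists>k\<in>Ob K. U = {P \<in> Spc K. k \<in> P}"
    using t(1) by blast
next
  assume "\<exists>k\<in>Ob K. U = {P \<in> Spc K. k \<in> P}"
  then show "openin (Spc_topology K) U \<and> compactin (Spc_topology K) U"
    using openin_Spc_basic compactin_Spc_basic by blast
qed

lemma patch_topology_Spc:
  "patch_topology (Spc_topology K) = topology_generated_by
     ({{P \<in> Spc K. l \<in> P} | l. l \<in> Ob K} \<union> {{P \<in> Spc K. k \<notin> P} | k. k \<in> Ob K})"
proof -
  have "{U. openin (Spc_topology K) U \<and> compactin (Spc_topology K) U} = {{P \<in> Spc K. l \<in> P} | l. l \<in> Ob K}"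
    unfolding compact_open_Spc_iff by blast
  moreover have "{topspace (Spc_topology K) - U |U. openin (Spc_topology K) U \<and> compactin (Spc_topology K) U}
      = {{P \<in> Spc K. k \<notin> P} | k. k \<in> Ob K}"
    unfolding compact_open_Spc_iff topspace_Spc_topology by blast
  ultimately show ?thesis
    unfolding patch_topology_def by simp
qed

lemma topspace_patch_topology_Spc: "topspace (patch_topology (Spc_topology K)) = Spc K"
proof -
  obtain z where "zero_object K z"
    using ex_zero_object by blast
  then have "z \<in> Ob K" "Spc K = {P \<in> Spc K. z \<in> P}"
    using zero_object_iff Spc_zero_object by auto
  then show ?thesis
    unfolding patch_topology_Spc topology_generated_by_topspace by blast
qed

lemma openin_patch_Spc_basic:
  assumes "k \<in> Ob K" "l \<in> Ob K"
  shows "openin (patch_topology (Spc_topology K)) {P \<in> Spc K. k \<notin> P \<and> l \<in> P}"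
proof -
  have "openin (patch_topology (Spc_topology K)) {P \<in> Spc K. k \<notin> P}"
    "openin (patch_topology (Spc_topology K)) {P \<in> Spc K. l \<in> P}"
    unfolding patch_topology_Spc by (rule topology_generated_by_Basis, use assms in blast)+
  moreover have "{P \<in> Spc K. k \<notin> P \<and> l \<in> P} = {P \<in> Spc K. k \<notin> P} \<inter> {P \<in> Spc K. l \<in> P}"
    by blast
  ultimately show ?thesis
    by (simp add: openin_Int)
qed

text \<open>Sets given by one excluded and one included object form a basis of the patch topology:
  to intersect two of them, tensor the excluded objects and add the included ones.\<close>

lemma openin_patch_SpcD:
  assumes "openin (patch_topology (Spc_topology K)) U" "P \<in> U"
  shows "\<exists>k\<in>Ob K. \<exists>l\<in>Ob K. k \<notin> P \<and> l \<in> P \<and> {Q \<in> Spc K. k \<notin> Q \<and> l \<in> Q} \<subseteq> U"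
proof -
  have P: "P \<in> Spc K"
    using openin_subset[OF assms(1)] assms(2) topspace_patch_topology_Spc by blast
  have "generate_topology_on
      ({{P \<in> Spc K. l \<in> P} | l. l \<in> Ob K} \<union> {{P \<in> Spc K. k \<notin> P} | k. k \<in> Ob K}) U"
    using assms(1) unfolding patch_topology_Spc openin_topology_generated_by_iff .
  then show ?thesis
    using assms(2)
  proof induction
    case (Int U V)
    then obtain k l where kl: "k \<in> Ob K" "l \<in> Ob K" "k \<notin> P" "l \<in> P" "{Q \<in> Spc K. k \<notin> Q \<and> l \<in> Q} \<subseteq> U"
      by blast
    obtain m n where mn: "m \<in> Ob K" "n \<in> Ob K" "m \<notin> P" "n \<in> P" "{Q \<in> Spc K. m \<notin> Q \<and> n \<in> Q} \<subseteq> V"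
      using Int by blast
    obtain z where z: "z \<in> Ob K" "\<And>P. P \<in> Spc K \<Longrightarrow> z \<in> P \<longleftrightarrow> l \<in> P \<and> n \<in> P"
      using ex_sum_object[OF kl(2) mn(2)] by blast
    have t: "k \<otimes>\<^sub>O m \<in> Q \<longleftrightarrow> k \<in> Q \<or> m \<in> Q" if "Q \<in> Spc K" for Q
      using SpcD(3)[OF that kl(1) mn(1)] .
    have "{Q \<in> Spc K. k \<otimes>\<^sub>O m \<notin> Q \<and> z \<in> Q} \<subseteq> U \<inter> V"
      using kl(5) mn(5) z(2) t by blast
    moreover have "k \<otimes>\<^sub>O m \<notin> P" "z \<in> P"
      using t[OF P] z(2)[OF P] kl mn by blast+
    ultimately show ?case
      using TensO_Ob[OF kl(1) mn(1)] z(1) by blast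
  next
    case (UN \<U>)
    then obtain V where V: "V \<in> \<U>"
      "\<exists>k\<in>Ob K. \<exists>l\<in>Ob K. k \<notin> P \<and> l \<in> P \<and> {Q \<in> Spc K. k \<notin> Q \<and> l \<in> Q} \<subseteq> V"
      by blast
    moreover have "V \<subseteq> \<Union>\<U>"
      using V(1) by blast
    ultimately show ?case
      by (meson subset_trans)
  next
    case (Basis B)
    obtain z where "zero_object K z"
      using ex_zero_object by blast
    then have z: "z \<in> Ob K" "z \<in> P"
      using zero_object_iff Spc_zero_object P by auto
    \<comment> \<open>A generator imposes only one of the two conditions; the other is made void by
      the unit, lying in no prime, or a zero object, lying in all.\<close>
    from Basis consider l where "l \<in> Ob K" "B = {P \<in> Spc K. l \<in> P}"
      | k where "k \<in> Ob K" "B = {P \<in> Spc K. k \<notin> P}"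
      by blast
    then show ?case
    proof cases
      case 1
      then show ?thesis
        using Basis(2) SpcD(2)[OF P] Unit_Ob by (intro bexI[of _ "Unit K"] bexI[of _ l]) auto
    next
      case 2
      then show ?thesis
        using Basis(2) z by (intro bexI[of _ k] bexI[of _ z]) auto
    qed
  qed simp
qed

lemma patch_dense_Spc_iff:
  assumes "S \<subseteq> Spc K"
  shows "patch_dense (Spc_topology K) S \<longleftrightarrow>
    (\<forall>k\<in>Ob K. \<forall>l\<in>Ob K. (\<exists>P\<in>Spc K. k \<notin> P \<and> l \<in> P) \<longrightarrow> (\<exists>P\<in>S. k \<notin> P \<and> l \<in> P))"
proof -
  let ?T = "patch_topology (Spc_topology K)"
  have "patch_dense (Spc_topology K) S \<longleftrightarrow> ?T closure_of S = Spc K"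
    unfolding patch_dense_def topspace_Spc_topology using assms by blast
  also have "\<dots> \<longleftrightarrow> (\<forall>P\<in>Spc K. P \<in> ?T closure_of S)"
    using closure_of_subset_topspace[of ?T S] unfolding topspace_patch_topology_Spc by blast
  also have "\<dots> \<longleftrightarrow> (\<forall>P\<in>Spc K. \<forall>U. P \<in> U \<and> openin ?T U \<longrightarrow> (\<exists>Q\<in>S. Q \<in> U))"
    unfolding in_closure_of topspace_patch_topology_Spc by blast
  also have "\<dots> \<longleftrightarrow>
    (\<forall>k\<in>Ob K. \<forall>l\<in>Ob K. (\<exists>P\<in>Spc K. k \<notin> P \<and> l \<in> P) \<longrightarrow> (\<exists>P\<in>S. k \<notin> P \<and> l \<in> P))"
    (is "?A \<longleftrightarrow> ?B")
  proof
    assume A: ?A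
    show ?B
    proof (intro ballI impI)
      fix k l assume kl: "k \<in> Ob K" "l \<in> Ob K" and "\<exists>P\<in>Spc K. k \<notin> P \<and> l \<in> P"
      then obtain P where P: "P \<in> Spc K" "P \<in> {P \<in> Spc K. k \<notin> P \<and> l \<in> P}"
        by blast
      then have "\<exists>Q\<in>S. Q \<in> {P \<in> Spc K. k \<notin> P \<and> l \<in> P}"
        using A[rule_format, OF P(1) conjI[OF P(2) openin_patch_Spc_basic[OF kl]]] by blast
      then show "\<exists>P\<in>S. k \<notin> P \<and> l \<in> P"
        by blast
    qed
  next
    assume B: ?B
    show ?A
    proof (intro ballI allI impI)
      fix P U assume P: "P \<in> Spc K" and U: "P \<in> U \<and> openin ?T U"
      obtain k l where kl: "k \<in> Ob K" "l \<in> Ob K" "k \<notin> P" "l \<in> P" "{Q \<in> Spc K. k \<notin> Q \<and> l \<in> Q} \<subseteq> U"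
        using openin_patch_SpcD U by blast
      then obtain Q where "Q \<in> S" "k \<notin> Q" "l \<in> Q"
        using B P by blast
      then show "\<exists>Q\<in>S. Q \<in> U"
        using kl(5) assms by blast
    qed
  qed
  finally show ?thesis .
qed

end

section \<open>Functoriality of the spectrum\<close>

locale tt_functor_between = K: tt_category K + L: tt_category L
  for K :: "('o, 'm, 'x) tt_data_scheme" and L :: "('p, 'n, 'y) tt_data_scheme" +
  fixes F :: "('o, 'm, 'p, 'n) tt_functor_data"
  assumes tt_functor: "tt_functor K L F"
begin

lemma additive: "additive_functor K L (FOb F) (FAr F)"
  using tt_functor unfolding tt_functor_def exact_functor_def by blast

lemma is_functor: "is_functor K L (FOb F) (FAr F)"
  using additive unfolding additive_functor_def by blast

lemma FAr_Hom: "f \<in> Hom K a b \<Longrightarrow> FAr F f \<in> Hom L (FOb F a) (FOb F b)"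
  using is_functor unfolding is_functor_def by blast

lemma FOb_Ob: "a \<in> Ob K \<Longrightarrow> FOb F a \<in> Ob L"
  using is_functor unfolding is_functor_def by blast

lemma FAr_Id: "a \<in> Ob K \<Longrightarrow> FAr F (Id K a) = Id L (FOb F a)"
  using is_functor unfolding is_functor_def by blast

lemma isomorphic_FOb_Unit: "isomorphic L (Unit L) (FOb F (Unit K))"
  using tt_functor unfolding tt_functor_def strong_symmetric_monoidal_def isomorphic_def by blast

lemma FMult_isos:
  "a \<in> Ob K \<Longrightarrow> b \<in> Ob K \<Longrightarrow> FMult F a b \<in> isos L (FOb F a \<otimes>\<^sub>O\<^bsub>L\<^esub> FOb F b) (FOb F (a \<otimes>\<^sub>O\<^bsub>K\<^esub> b))"
  using tt_functor unfolding tt_functor_def strong_symmetric_monoidal_def by blast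

lemma FMult_natural:
  "f \<in> Hom K a a' \<Longrightarrow> g \<in> Hom K b b' \<Longrightarrow>
    FMult F a' b' \<cdot>\<^bsub>L\<^esub> (FAr F f \<otimes>\<^sub>A\<^bsub>L\<^esub> FAr F g) = FAr F (f \<otimes>\<^sub>A\<^bsub>K\<^esub> g) \<cdot>\<^bsub>L\<^esub> FMult F a b"
  using tt_functor unfolding tt_functor_def strong_symmetric_monoidal_def by blast

lemma arrow_iso_FAr_TensA:
  assumes f: "f \<in> Hom K a a'" and g: "g \<in> Hom K b b'"
  shows "arrow_iso L (FAr F f \<otimes>\<^sub>A\<^bsub>L\<^esub> FAr F g) (FAr F (f \<otimes>\<^sub>A\<^bsub>K\<^esub> g))"
proof -
  have O: "a \<in> Ob K" "a' \<in> Ob K" "b \<in> Ob K" "b' \<in> Ob K"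
    using K.Hom_Ob[OF f] K.Hom_Ob[OF g] by blast+
  show ?thesis
    by (rule L.arrow_isoI[OF L.TensA_Hom[OF FAr_Hom[OF f] FAr_Hom[OF g]] FAr_Hom[OF K.TensA_Hom[OF f g]]
          FMult_isos[OF O(1,3)] FMult_isos[OF O(2,4)] FMult_natural[OF f g]])
qed

text \<open>\<open>FUnit\<close> starts the induction and naturality of \<open>FMult\<close> adds a
  factor.\<close>

lemma arrow_iso_FAr_tensor_power:
  assumes f: "f \<in> Hom K a b"
  shows "arrow_iso L (tensor_power_ar L (FAr F f) s) (FAr F (tensor_power_ar K f s))"
proof (induction s)
  case 0
  show ?case
    using isomorphic_FOb_Unit unfolding L.arrow_iso_Id by (simp add: FAr_Id K.Unit_Ob)
next
  case (Suc s)
  show ?case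
    using L.arrow_iso_trans[OF L.arrow_iso_TensA[OF Suc L.arrow_iso_refl[OF FAr_Hom[OF f]]]
        arrow_iso_FAr_TensA[OF K.tensor_power_ar_Hom[OF f] f]] by simp
qed

lemma null_arrow_FAr:
  assumes f: "f \<in> Hom K a b" and n: "null_arrow K f"
  shows "null_arrow L (FAr F f)"
proof -
  have O: "a \<in> Ob K" "b \<in> Ob K"
    using K.Hom_Ob[OF f] by blast+
  show ?thesis
    using additive_functor_Zero[OF K.additive_category_axioms L.additive_category_axioms additive O] n
    unfolding K.null_arrow_iff[OF f] L.null_arrow_iff[OF FAr_Hom[OF f]] by simp
qed

text \<open>Ensures that a prime of \<open>L\<close> containing the nilpotence ideal of the image
  arrow pulls back to a prime containing \<open>m\<close>.\<close>

lemma FOb_nilpotence_ideal: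
  assumes f: "f \<in> Hom K a b" and m: "m \<in> K.nilpotence_ideal f"
  shows "FOb F m \<in> L.nilpotence_ideal (FAr F f)"
proof -
  obtain s where O: "m \<in> Ob K" and s: "null_arrow K (tensor_power_ar K f s \<otimes>\<^sub>A\<^bsub>K\<^esub> Id K m)"
    using m unfolding K.nilpotence_ideal_def by blast
  note H = K.tensor_power_ar_Hom[OF f] and I = K.Id_Hom[OF O]
  have "null_arrow L (FAr F (tensor_power_ar K f s \<otimes>\<^sub>A\<^bsub>K\<^esub> Id K m))"
    using null_arrow_FAr[OF K.TensA_Hom[OF H I] s] .
  then have "null_arrow L (FAr F (tensor_power_ar K f s) \<otimes>\<^sub>A\<^bsub>L\<^esub> FAr F (Id K m))"
    using L.null_arrow_iso_iff[OF arrow_iso_FAr_TensA[OF H I]] by blast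
  then have "null_arrow L (tensor_power_ar L (FAr F f) s \<otimes>\<^sub>A\<^bsub>L\<^esub> Id L (FOb F m))"
    using L.null_arrow_iso_iff[OF L.arrow_iso_TensA[OF arrow_iso_FAr_tensor_power[OF f]
          L.arrow_iso_refl[OF FAr_Hom[OF I]]]] FAr_Id[OF O] by simp
  then show ?thesis
    unfolding L.nilpotence_ideal_def using FOb_Ob[OF O] by blast
qed

lemma cone_in_FAr:
  assumes "dist_triangle K a b c f g h" "FOb F c \<in> Q"
  shows "L.cone_in Q (FAr F f)"
  using tt_functor assms unfolding tt_functor_def exact_functor_def L.cone_in_def by blast

lemma Spc_map_in_Spc:
  assumes Q: "Q \<in> Spc L"
  shows "Spc_map K F Q \<in> Spc K"
proof -
  note I = L.SpcD(1)[OF Q]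
  have ex: "exact_functor K L (FOb F) (FAr F) (FShift F)"
    using tt_functor unfolding tt_functor_def by blast
  have tens: "FOb F (k \<otimes>\<^sub>O\<^bsub>K\<^esub> l) \<in> Q \<longleftrightarrow> FOb F k \<in> Q \<or> FOb F l \<in> Q"
    if "k \<in> Ob K" "l \<in> Ob K" for k l
  proof -
    have i: "isomorphic L (FOb F k \<otimes>\<^sub>O\<^bsub>L\<^esub> FOb F l) (FOb F (k \<otimes>\<^sub>O\<^bsub>K\<^esub> l))"
      using L.isomorphicI[OF FMult_isos[OF that]] .
    have "FOb F (k \<otimes>\<^sub>O\<^bsub>K\<^esub> l) \<in> Q \<longleftrightarrow> FOb F k \<otimes>\<^sub>O\<^bsub>L\<^esub> FOb F l \<in> Q"
      using L.tt_idealD(3)[OF I _ i] L.tt_idealD(3)[OF I _ L.isomorphic_sym[OF i]] by blast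
    then show ?thesis
      using L.SpcD(3)[OF Q FOb_Ob[OF that(1)] FOb_Ob[OF that(2)]] by blast
  qed
  have "thick_subcategory K (Spc_map K F Q)"
    unfolding Spc_map_def
    by (rule thick_subcategory_preimage[OF K.triangulated_category_axioms L.triangulated_category_axioms ex
          L.tt_ideal_thick[OF I]])
  moreover have "FOb F (Unit K) \<notin> Q"
    using L.tt_idealD(3)[OF I _ L.isomorphic_sym[OF isomorphic_FOb_Unit]] L.SpcD(2)[OF Q] by blast
  then have "Spc_map K F Q \<noteq> Ob K"
    using K.Unit_Ob unfolding Spc_map_def by blast
  ultimately show ?thesis
    using tens K.TensO_Ob unfolding Spc_def prime_tt_ideal_def tt_ideal_def Spc_map_def by auto
qed

end

section \<open>Arrows with prescribed nilpotence ideal\<close>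

context rigid_tt_category
begin

text \<open>The coevaluation becomes a split monomorphism after tensoring with l, so the connecting
  map h of its cone is annihilated by l.\<close>

lemma ex_null_connecting_arrow:
  assumes l: "l \<in> Ob K"
  obtains d e c u v h where "d \<in> Ob K" "e = l \<otimes>\<^sub>O d" "dist_triangle K (Unit K) e c u v h"
    "null_arrow K (h \<otimes>\<^sub>A Id K l)"
proof -
  obtain d where d: "d \<in> Ob K" "is_dual K l d"
    using ex_dual[OF l] by auto
  let ?e = "l \<otimes>\<^sub>O d" and ?l = "Unit K \<otimes>\<^sub>O l"
  obtain coev ev where coev: "coev \<in> Hom K (Unit K) ?e" and ev: "ev \<in> Hom K (d \<otimes>\<^sub>O l) (Unit K)"
    and dual: "RUnit K l \<cdot> (Id K l \<otimes>\<^sub>A ev) \<cdot> Assoc K l d l \<cdot> (coev \<otimes>\<^sub>A Id K l) = LUnit K l"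
    using d(2) unfolding is_dual_def by auto
  obtain c v h where t: "dist_triangle K (Unit K) ?e c coev v h"
    using Tri_cone[OF coev] by auto
  note H = dist_triangle_Hom[OF t]
  note I = Id_Hom[OF l]
  let ?s = "coev \<otimes>\<^sub>A Id K l" and ?h = "h \<otimes>\<^sub>A Id K l"
  have s: "?s \<in> Hom K ?l (?e \<otimes>\<^sub>O l)" and h: "?h \<in> Hom K (c \<otimes>\<^sub>O l) (ShiftO K (Unit K) \<otimes>\<^sub>O l)"
    using TensA_Hom[OF coev I] TensA_Hom[OF H(3) I] .
  obtain l' where l': "l' \<in> isos K l ?l" "l' \<cdot> LUnit K l = Id K ?l"
    using isos_sym[OF LUnit_iso[OF l]] by auto
  have A: "Assoc K l d l \<in> Hom K (?e \<otimes>\<^sub>O l) (l \<otimes>\<^sub>O (d \<otimes>\<^sub>O l))"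
    using isos_Hom[OF Assoc_iso[OF l d(1) l]] .
  note E = TensA_Hom[OF I ev] and R = isos_Hom[OF RUnit_iso[OF l]]
  \<comment> \<open>By the first duality identity \<open>q\<close> retracts the coevaluation
    tensored with \<open>l\<close>, up to the left unitor, which \<open>l'\<close> inverts.\<close>
  define q where "q = RUnit K l \<cdot> ((Id K l \<otimes>\<^sub>A ev) \<cdot> Assoc K l d l)"
  have q: "q \<in> Hom K (?e \<otimes>\<^sub>O l) l"
    unfolding q_def using Comp_Hom[OF Comp_Hom[OF A E] R] .
  have "q \<cdot> ?s = LUnit K l"
    unfolding q_def dual[symmetric]
    using Comp_assoc[OF s Comp_Hom[OF A E] R] Comp_assoc[OF s A E] by simp
  then have r: "(l' \<cdot> q) \<cdot> ?s = Id K ?l"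
    using Comp_assoc[OF s q isos_Hom[OF l'(1)]] l'(2) by simp
  have lq: "l' \<cdot> q \<in> Hom K (?e \<otimes>\<^sub>O l) ?l"
    using Comp_Hom[OF q isos_Hom[OF l'(1)]] .
  obtain \<theta> where \<theta>: "exact_functor K K (\<lambda>x. x \<otimes>\<^sub>O l) (\<lambda>f. f \<otimes>\<^sub>A Id K l) \<theta>"
    using tensor_exact_left[OF l] by auto
  have \<theta>1: "\<theta> (Unit K) \<in> isos K (ShiftO K (Unit K) \<otimes>\<^sub>O l) (ShiftO K ?l)"
    using \<theta> Unit_Ob unfolding exact_functor_def natural_iso_def by auto
  let ?k = "\<theta> (Unit K) \<cdot> ?h"
  have "dist_triangle K ?l (?e \<otimes>\<^sub>O l) (c \<otimes>\<^sub>O l) ?s (v \<otimes>\<^sub>A Id K l) ?k"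
    using \<theta> t unfolding exact_functor_def by auto
  \<comment> \<open>Two rotations make \<open>?k\<close> and the negated shift of \<open>?s\<close>
    consecutive, so they compose to zero.\<close>
  then have "hom_neg K (ShiftA K ?s) \<cdot> ?k = Zero K (c \<otimes>\<^sub>O l) (ShiftO K (?e \<otimes>\<^sub>O l))"
    using dist_triangle_Comp[OF dist_triangle_rotate[OF dist_triangle_rotate]] by auto
  moreover have k: "?k \<in> Hom K (c \<otimes>\<^sub>O l) (ShiftO K ?l)"
    using Comp_Hom[OF h isos_Hom[OF \<theta>1]] .
  ultimately have sk: "ShiftA K ?s \<cdot> ?k = Zero K (c \<otimes>\<^sub>O l) (ShiftO K (?e \<otimes>\<^sub>O l))"
    using Comp_hom_neg_left[OF k ShiftA_Hom[OF s]] by simp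
  \<comment> \<open>The shift of \<open>?s\<close> is a split monomorphism, so \<open>?k\<close>
    itself vanishes.\<close>
  have "ShiftA K (l' \<cdot> q) \<cdot> ShiftA K ?s = Id K (ShiftO K ?l)"
    using shift_additive s lq r Hom_Ob[OF s] unfolding additive_functor_def is_functor_def by metis
  then have "?k = ShiftA K (l' \<cdot> q) \<cdot> (ShiftA K ?s \<cdot> ?k)"
    using Comp_assoc[OF k ShiftA_Hom[OF s] ShiftA_Hom[OF lq]] Id_left[OF k] by simp
  then have k0: "?k = Zero K (c \<otimes>\<^sub>O l) (ShiftO K ?l)"
    unfolding sk using Comp_Zero_right[OF ShiftA_Hom[OF lq]] Hom_Ob[OF h] by simp
  obtain \<theta>' where \<theta>': "\<theta>' \<in> isos K (ShiftO K ?l) (ShiftO K (Unit K) \<otimes>\<^sub>O l)"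
    "\<theta>' \<cdot> \<theta> (Unit K) = Id K (ShiftO K (Unit K) \<otimes>\<^sub>O l)"
    using isos_sym[OF \<theta>1] by auto
  \<comment> \<open>Undoing the comparison isomorphism between tensoring and shifting passes from
    \<open>?k\<close> back to \<open>?h\<close>.\<close>
  have "?h = \<theta>' \<cdot> ?k"
    using Comp_assoc[OF h isos_Hom[OF \<theta>1] isos_Hom[OF \<theta>'(1)]] \<theta>'(2) Id_left[OF h] by simp
  then have "?h = Zero K (c \<otimes>\<^sub>O l) (ShiftO K (Unit K) \<otimes>\<^sub>O l)"
    unfolding k0 using Comp_Zero_right[OF isos_Hom[OF \<theta>'(1)]] Hom_Ob[OF h] by simp
  then have "null_arrow K ?h"
    unfolding null_arrow_iff[OF h] .
  then show thesis
    using that[OF d(1) refl t] by blast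
qed

text \<open>Take \<open>h\<close> tensor \<open>k\<close>, whose cone is the shift of l tensor its
  dual, tensored with \<open>k\<close>. This cone lies in every tt-ideal containing
  \<open>l\<close>: for the nilpotence ideal that gives nilpotence on the cone, for a prime it gives
  \<open>cone_in\<close>.\<close>

lemma ex_detecting_arrow:
  assumes k: "k \<in> Ob K" and l: "l \<in> Ob K"
  obtains f c b where "f \<in> Hom K (c \<otimes>\<^sub>O k) b" "c \<in> Ob K" "tensor_nilpotent_on_cone K f"
    "l \<in> nilpotence_ideal f" "\<And>P. P \<in> Spc K \<Longrightarrow> l \<in> P \<Longrightarrow> c \<notin> P \<and> cone_in P f"
proof -
  obtain d e c u v h where d: "d \<in> Ob K" and e: "e = l \<otimes>\<^sub>O d"
    and t: "dist_triangle K (Unit K) e c u v h" and h0: "null_arrow K (h \<otimes>\<^sub>A Id K l)"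
    by (rule ex_null_connecting_arrow[OF l])
  let ?U = "ShiftO K (Unit K)" and ?x = "ShiftO K e"
  let ?f = "h \<otimes>\<^sub>A Id K k"
  note t2 = dist_triangle_rotate[OF dist_triangle_rotate[OF t]]
  note h = dist_triangle_Hom(3)[OF t]
  note I = Id_Hom[OF k] Id_Hom[OF l]
  have c: "c \<in> Ob K"
    using Hom_Ob[OF h] by blast
  have eO: "e \<in> Ob K"
    unfolding e using TensO_Ob[OF l d] .
  have f: "?f \<in> Hom K (c \<otimes>\<^sub>O k) (?U \<otimes>\<^sub>O k)"
    using TensA_Hom[OF h I(1)] .
  obtain g' h' where tf: "dist_triangle K (c \<otimes>\<^sub>O k) (?U \<otimes>\<^sub>O k) (?x \<otimes>\<^sub>O k) ?f g' h'"
    using tensor_exact_left[OF k] t2 unfolding exact_functor_def by blast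
  have mem: "?x \<otimes>\<^sub>O k \<in> J" if J: "tt_ideal K J" "l \<in> J" for J
  proof -
    have "e \<in> J"
      unfolding e using tt_ideal_TensO_right[OF J d] .
    then have "?x \<in> J"
      using tt_idealD(4)[OF J(1) eO] by blast
    then show ?thesis
      using tt_ideal_TensO_right[OF J(1) _ k] by blast
  qed
  have lN: "l \<in> nilpotence_ideal ?f"
  proof -
    have "arrow_iso K ((h \<otimes>\<^sub>A Id K l) \<otimes>\<^sub>A Id K k) (?f \<otimes>\<^sub>A Id K l)"
      using arrow_iso_trans[OF arrow_iso_Assoc[OF h I(2,1)]
          arrow_iso_trans[OF arrow_iso_TensA[OF arrow_iso_refl[OF h] arrow_iso_Braid[OF I(2,1)]]
            arrow_iso_sym[OF arrow_iso_Assoc[OF h I]]]] .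
    then have "null_arrow K (?f \<otimes>\<^sub>A Id K l)"
      using null_arrow_iso null_arrow_TensA[OF TensA_Hom[OF h I(2)] I(1)] h0 by blast
    \<comment> \<open>The first tensor power carries a leading unit factor, which has to be
      inserted.\<close>
    then have "null_arrow K (Id K (Unit K) \<otimes>\<^sub>A (?f \<otimes>\<^sub>A Id K l))"
      using null_arrow_TensA[OF Id_Hom[OF Unit_Ob] TensA_Hom[OF f I(2)]] by blast
    then have "null_arrow K (tensor_power_ar K ?f 1 \<otimes>\<^sub>A Id K l)"
      using null_arrow_iso_iff[OF arrow_iso_Assoc[OF Id_Hom[OF Unit_Ob] f I(2)]] by simp
    then show ?thesis
      unfolding nilpotence_ideal_def using l by blast
  qed
  have "?x \<otimes>\<^sub>O k \<in> nilpotence_ideal ?f"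
    using mem[OF tt_ideal_nilpotence_ideal[OF f] lN] .
  then have "tensor_nilpotent_on K ?f (?x \<otimes>\<^sub>O k)"
    using tensor_nilpotent_on_iff[OF f] unfolding nilpotence_ideal_def by blast
  moreover have "Dom K ?f = c \<otimes>\<^sub>O k" "Cod K ?f = ?U \<otimes>\<^sub>O k"
    using f by (simp_all add: Hom_def)
  ultimately have "tensor_nilpotent_on_cone K ?f"
    unfolding tensor_nilpotent_on_cone_def using tf by auto
  moreover have "c \<notin> P \<and> cone_in P ?f" if P: "P \<in> Spc K" "l \<in> P" for P
  proof -
    note J = SpcD(1)[OF P(1)]
    have "cone_in P ?f"
      unfolding cone_in_def using tf mem[OF J P(2)] by blast
    moreover have "e \<in> P"
      unfolding e using tt_ideal_TensO_right[OF J P(2) d] .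
    \<comment> \<open>If \<open>c\<close> were in \<open>P\<close> along with \<open>e\<close>, the
      triangle would put the unit into \<open>P\<close>.\<close>
    then have "c \<notin> P"
      using tt_idealD(6)[OF J t] SpcD(2)[OF P(1)] by blast
    ultimately show ?thesis
      by blast
  qed
  ultimately show thesis
    using that[OF f c _ lN] by blast
qed

end

section \<open>Detection of nilpotence and density\<close>

theorem theorem1p2:
  fixes K :: "('o, 'm) tt_data"
    and I :: "'i set"
    and L :: "'i \<Rightarrow> ('p, 'n) tt_data"
    and F :: "'i \<Rightarrow> ('o, 'm, 'p, 'n) tt_functor_data"
  assumes "rigid_tt_category K"
    and "\<And>i. i \<in> I \<Longrightarrow> tt_category (L i)"
    and "\<And>i. i \<in> I \<Longrightarrow> tt_functor K (L i) (F i)"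
  shows "(jointly_detect_tensor_nilpotence_on_cone K I L F \<longleftrightarrow>
            patch_dense (Spc_topology K) (\<Union>i\<in>I. Spc_map K (F i) ` Spc (L i))) \<and>
         (patch_dense (Spc_topology K) (\<Union>i\<in>I. Spc_map K (F i) ` Spc (L i)) \<longleftrightarrow>
            jointly_distinguish_supports K I (\<lambda>i. Spc (L i)) (\<lambda>i. Spc_map K (F i)))"
proof -
  interpret K: rigid_tt_category K by fact
  have between: "tt_functor_between K (L i) (F i)" if "i \<in> I" for i
    using K.tt_category_axioms assms(2,3)[OF that]
    by (intro tt_functor_between.intro tt_functor_between_axioms.intro)
  note map_Spc = tt_functor_between.Spc_map_in_Spc[OF between]
  let ?S = "\<Union>i\<in>I. Spc_map K (F i) ` Spc (L i)"
  \<comment> \<open>The intermediate condition, with membership in a pulled-back prime spelled out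
    in \<open>L i\<close>.\<close>
  define D where "D \<longleftrightarrow> (\<forall>k\<in>Ob K. \<forall>l\<in>Ob K. (\<exists>P\<in>Spc K. k \<notin> P \<and> l \<in> P) \<longrightarrow>
    (\<exists>i\<in>I. \<exists>Q\<in>Spc (L i). FOb (F i) k \<notin> Q \<and> FOb (F i) l \<in> Q))"
  have mem: "k \<in> Spc_map K (F i) Q \<longleftrightarrow> FOb (F i) k \<in> Q" if "k \<in> Ob K" for k i Q
    using that by (simp add: Spc_map_def)
  have "?S \<subseteq> Spc K"
    using map_Spc by blast
  then have dense: "patch_dense (Spc_topology K) ?S \<longleftrightarrow> D"
    unfolding K.patch_dense_Spc_iff[OF \<open>?S \<subseteq> Spc K\<close>] D_def using mem by simp
  have supp: "Spc_map K (F i) Q \<in> supp K k \<longleftrightarrow> FOb (F i) k \<notin> Q"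
    if "i \<in> I" "Q \<in> Spc (L i)" "k \<in> Ob K" for i Q k
    using map_Spc[OF that(1,2)] mem[OF that(3)] unfolding supp_def by simp
  have dist: "jointly_distinguish_supports K I (\<lambda>i. Spc (L i)) (\<lambda>i. Spc_map K (F i)) \<longleftrightarrow> D"
  proof
    assume J: "jointly_distinguish_supports K I (\<lambda>i. Spc (L i)) (\<lambda>i. Spc_map K (F i))"
    show D
      unfolding D_def
    proof (intro ballI impI, rule ccontr)
      fix k l assume k: "k \<in> Ob K" and l: "l \<in> Ob K" and ex: "\<exists>P\<in>Spc K. k \<notin> P \<and> l \<in> P"
        and n: "\<not> (\<exists>i\<in>I. \<exists>Q\<in>Spc (L i). FOb (F i) k \<notin> Q \<and> FOb (F i) l \<in> Q)"
      \<comment> \<open>If no pulled-back prime separates \<open>k\<close> from \<open>l\<close>,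
        the supports of \<open>z\<close> = k + l and of \<open>l\<close> have the same preimages;
        equal supports then mean that supp k is contained in supp l.\<close>
      obtain z where z: "z \<in> Ob K" "\<And>P. P \<in> Spc K \<Longrightarrow> z \<in> P \<longleftrightarrow> k \<in> P \<and> l \<in> P"
        using K.ex_sum_object[OF k l] by blast
      have Fz: "FOb (F i) z \<in> Q \<longleftrightarrow> FOb (F i) k \<in> Q \<and> FOb (F i) l \<in> Q"
        if "i \<in> I" "Q \<in> Spc (L i)" for i Q
        using z(2)[OF map_Spc[OF that]] unfolding mem[OF k] mem[OF l] mem[OF z(1)] .
      have "\<forall>i\<in>I. {Q \<in> Spc (L i). Spc_map K (F i) Q \<in> supp K z}
          = {Q \<in> Spc (L i). Spc_map K (F i) Q \<in> supp K l}"
        using supp[OF _ _ z(1)] supp[OF _ _ l] Fz n by blast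
      then have "supp K z = supp K l"
        using J z(1) l unfolding jointly_distinguish_supports_def by blast
      then show False
        using ex z(2) unfolding supp_def by blast
    qed
  next
    assume D: D
    \<comment> \<open>The hypothesis is symmetric in \<open>k\<close> and \<open>l\<close>, so one
      inclusion suffices.\<close>
    have sub: "supp K k \<subseteq> supp K l" if k: "k \<in> Ob K" and l: "l \<in> Ob K"
      and e: "\<forall>i\<in>I. {Q \<in> Spc (L i). Spc_map K (F i) Q \<in> supp K k}
          = {Q \<in> Spc (L i). Spc_map K (F i) Q \<in> supp K l}" for k l
    proof (rule ccontr)
      assume "\<not> supp K k \<subseteq> supp K l"
      then have "\<exists>P\<in>Spc K. k \<notin> P \<and> l \<in> P"
        unfolding supp_def by blast
      then obtain i Q where iQ: "i \<in> I" "Q \<in> Spc (L i)" "FOb (F i) k \<notin> Q" "FOb (F i) l \<in> Q"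
        using D k l unfolding D_def by blast
      then have "Spc_map K (F i) Q \<in> supp K k" "Spc_map K (F i) Q \<notin> supp K l"
        using supp[OF iQ(1,2) k] supp[OF iQ(1,2) l] by auto
      then show False
        using e iQ(1,2) by blast
    qed
    show "jointly_distinguish_supports K I (\<lambda>i. Spc (L i)) (\<lambda>i. Spc_map K (F i))"
      unfolding jointly_distinguish_supports_def
    proof (intro ballI impI)
      fix k l assume "k \<in> Ob K" "l \<in> Ob K"
        "\<forall>i\<in>I. {Q \<in> Spc (L i). Spc_map K (F i) Q \<in> supp K k}
          = {Q \<in> Spc (L i). Spc_map K (F i) Q \<in> supp K l}"
      then show "supp K k = supp K l"
        using sub[of k l] sub[of l k] by auto
    qed
  qed
  have detect: "jointly_detect_tensor_nilpotence_on_cone K I L F \<longleftrightarrow> D"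
  proof
    assume J: "jointly_detect_tensor_nilpotence_on_cone K I L F"
    show D
      unfolding D_def
    proof (intro ballI impI, rule ccontr)
      fix k l assume k: "k \<in> Ob K" and l: "l \<in> Ob K" and ex: "\<exists>P\<in>Spc K. k \<notin> P \<and> l \<in> P"
        and n: "\<not> (\<exists>i\<in>I. \<exists>Q\<in>Spc (L i). FOb (F i) k \<notin> Q \<and> FOb (F i) l \<in> Q)"
      obtain P where P: "P \<in> Spc K" "k \<notin> P" "l \<in> P"
        using ex by blast
      obtain f c b where f: "f \<in> Hom K (c \<otimes>\<^sub>O\<^bsub>K\<^esub> k) b" and c: "c \<in> Ob K"
        and cone: "tensor_nilpotent_on_cone K f" and lN: "l \<in> K.nilpotence_ideal f"
        and prime: "\<And>P. P \<in> Spc K \<Longrightarrow> l \<in> P \<Longrightarrow> c \<notin> P \<and> K.cone_in P f"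
        by (rule K.ex_detecting_arrow[OF k l]) (rule that)
      have "tensor_nilpotent (L i) (FAr (F i) f)" if i: "i \<in> I" for i
      proof (rule ccontr)
        interpret Fi: tt_functor_between K "L i" "F i"
          using between[OF i] .
        assume "\<not> tensor_nilpotent (L i) (FAr (F i) f)"
        \<comment> \<open>This \<open>Q\<close> contains the image of \<open>l\<close> and avoids
          that of c tensor k, hence that of \<open>k\<close>: exactly the separating prime excluded
          by \<open>n\<close>.\<close>
        then obtain Q where Q: "Q \<in> Spc (L i)" "Fi.L.nilpotence_ideal (FAr (F i) f) \<subseteq> Q"
          "FOb (F i) (c \<otimes>\<^sub>O\<^bsub>K\<^esub> k) \<notin> Q"
          using Fi.L.not_tensor_nilpotent_ex_prime[OF Fi.FAr_Hom[OF f]] by blast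
        have "c \<otimes>\<^sub>O\<^bsub>K\<^esub> k \<notin> Spc_map K (F i) Q"
          using Q(3) mem[OF K.TensO_Ob[OF c k]] by blast
        then have "k \<notin> Spc_map K (F i) Q"
          using K.SpcD(3)[OF map_Spc[OF i Q(1)] c k] by blast
        moreover have "FOb (F i) l \<in> Q"
          using Fi.FOb_nilpotence_ideal[OF f lN] Q(2) by blast
        ultimately show False
          using n i Q(1) mem[OF k] by blast
      qed
      moreover have "f \<in> Ar K"
        using f by (simp add: Hom_def)
      ultimately have "tensor_nilpotent K f"
        using J cone unfolding jointly_detect_tensor_nilpotence_on_cone_def by blast
      \<comment> \<open>Nilpotence of \<open>f\<close> with its cone in \<open>P\<close> forces the
        source into \<open>P\<close>, although neither \<open>c\<close> nor \<open>k\<close> lies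
        there.\<close>
      then have "c \<otimes>\<^sub>O\<^bsub>K\<^esub> k \<in> P"
        using K.tensor_nilpotent_cone_in_prime[OF P(1) f] prime[OF P(1,3)] by blast
      then show False
        using K.SpcD(3)[OF P(1) c k] prime[OF P(1,3)] P(2) by blast
    qed
  next
    assume D: D
    show "jointly_detect_tensor_nilpotence_on_cone K I L F"
      unfolding jointly_detect_tensor_nilpotence_on_cone_def
    proof (intro ballI impI, rule ccontr)
      fix f assume fA: "f \<in> Ar K" and cone: "tensor_nilpotent_on_cone K f"
        and nil: "\<forall>i\<in>I. tensor_nilpotent (L i) (FAr (F i) f)" and n: "\<not> tensor_nilpotent K f"
      let ?a = "Dom K f" and ?b = "Cod K f"
      have f: "f \<in> Hom K ?a ?b"
        using fA by (simp add: Hom_def)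
      have a: "?a \<in> Ob K"
        using K.Hom_Ob[OF f] by blast
      obtain m g h where t: "dist_triangle K ?a ?b m f g h" and m: "tensor_nilpotent_on K f m"
        using cone unfolding tensor_nilpotent_on_cone_def by blast
      have mO: "m \<in> Ob K"
        using K.Hom_Ob[OF K.dist_triangle_Hom(2)[OF t]] by blast
      then have "m \<in> K.nilpotence_ideal f"
        using m K.tensor_nilpotent_on_iff[OF f mO] unfolding K.nilpotence_ideal_def by blast
      then obtain P where "P \<in> Spc K" "m \<in> P" "?a \<notin> P"
        using K.not_tensor_nilpotent_ex_prime[OF f n] by blast
      \<comment> \<open>Condition \<open>D\<close> is applied to the source of \<open>f\<close> and
        its cone \<open>m\<close>, which \<open>P\<close> separates.\<close>
      then obtain i Q where i: "i \<in> I" and Q: "Q \<in> Spc (L i)" "FOb (F i) ?a \<notin> Q" "FOb (F i) m \<in> Q"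
        using D a mO unfolding D_def by blast
      interpret Fi: tt_functor_between K "L i" "F i"
        using between[OF i] .
      have "tensor_nilpotent (L i) (FAr (F i) f)"
        using nil i by blast
      \<comment> \<open>The image of \<open>m\<close> is a cone of the image of \<open>f\<close> and
        lies in \<open>Q\<close>, so nilpotence there contradicts the choice of
        \<open>Q\<close>.\<close>
      then have "FOb (F i) ?a \<in> Q"
        using Fi.L.tensor_nilpotent_cone_in_prime[OF Q(1) Fi.FAr_Hom[OF f] _ Fi.cone_in_FAr[OF t Q(3)]]
        by blast
      then show False
        using Q(2) by blast
    qed
  qed
  show ?thesis
    unfolding detect dense dist by blast
qed

end
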